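(* Let $G$ be a finitely generated amenable group. Then $G$ has Property (NL) if and only if $G$ does not surject onto $\mathbb{Z}$ or onto the infinite dihedral group $\mathbb{D}_\infty$ (that is, $G$ admits neither a surjective homomorphism to $\mathbb{Z}$ nor one to $\mathbb{D}_\infty$).
   Context: A hyperbolic space is a geodesic metric space that is Gromov hyperbolic (not necessarily proper). Actions on hyperbolic spaces are by isometries. For an action of a group $G$ on a hyperbolic space $X$, an element $g\in G$ is loxodromic if $n\mapsto g^n x$, $n \in \mathbb{Z}$, is a quasi-isometric embedding $\mathbb{Z}\to X$ for some (equivalently any) $x\in X$. A group $G$ has Property (NL) if no isometric action of $G$ on a hyperbolic space admits a loxodromic element. *)

theory Defs
  imports
    "HOL-Library.Equipollence"
    "HOL-Analysis.Abstract_Metric_Spaces"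
    "HOL-Algebra.Generated_Groups"
    "HOL-Algebra.Group_Action"
    "HOL-Algebra.Elementary_Groups"
begin

definition finitely_generated_group :: "('a, 'b) monoid_scheme \<Rightarrow> bool" where
  "finitely_generated_group G \<longleftrightarrow>
     (\<exists>S. finite S \<and> S \<subseteq> carrier G \<and> generate G S = carrier G)"

text \<open>Functions on a group are total functions on the ambient type; only their values on the
  carrier matter. In particular linearity and positivity force an invariant mean to depend
  only on the restriction of its argument to the carrier.\<close>

definition bounded_functions :: "('a, 'b) monoid_scheme \<Rightarrow> ('a \<Rightarrow> real) set" where
  "bounded_functions G = {f. bounded (f ` carrier G)}"

definition left_invariant_mean ::
    "('a, 'b) monoid_scheme \<Rightarrow> (('a \<Rightarrow> real) \<Rightarrow> real) \<Rightarrow> bool" where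
  "left_invariant_mean G \<mu> \<longleftrightarrow>
     (\<forall>f\<in>bounded_functions G. \<forall>h\<in>bounded_functions G. \<mu> (\<lambda>x. f x + h x) = \<mu> f + \<mu> h) \<and>
     (\<forall>f\<in>bounded_functions G. \<forall>c. \<mu> (\<lambda>x. c * f x) = c * \<mu> f) \<and>
     (\<forall>f\<in>bounded_functions G. (\<forall>x\<in>carrier G. 0 \<le> f x) \<longrightarrow> 0 \<le> \<mu> f) \<and>
     \<mu> (\<lambda>_. 1) = 1 \<and>
     (\<forall>f\<in>bounded_functions G. \<forall>g\<in>carrier G. \<mu> (\<lambda>x. f (g \<otimes>\<^bsub>G\<^esub> x)) = \<mu> f)"

definition amenable_group :: "('a, 'b) monoid_scheme \<Rightarrow> bool" where
  "amenable_group G \<longleftrightarrow> (\<exists>\<mu>. left_invariant_mean G \<mu>)"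

definition geodesic_space :: "'x set \<Rightarrow> ('x \<Rightarrow> 'x \<Rightarrow> real) \<Rightarrow> bool" where
  "geodesic_space M d \<longleftrightarrow>
     (\<forall>x\<in>M. \<forall>y\<in>M. \<exists>\<gamma> :: real \<Rightarrow> 'x.
        \<gamma> 0 = x \<and> \<gamma> (d x y) = y \<and> \<gamma> ` {0..d x y} \<subseteq> M \<and>
        (\<forall>s\<in>{0..d x y}. \<forall>t\<in>{0..d x y}. d (\<gamma> s) (\<gamma> t) = \<bar>s - t\<bar>))"

definition gromov_product :: "('x \<Rightarrow> 'x \<Rightarrow> real) \<Rightarrow> 'x \<Rightarrow> 'x \<Rightarrow> 'x \<Rightarrow> real" where
  "gromov_product d w x y = (d x w + d y w - d x y) / 2"

definition gromov_hyperbolic :: "'x set \<Rightarrow> ('x \<Rightarrow> 'x \<Rightarrow> real) \<Rightarrow> bool" where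
  "gromov_hyperbolic M d \<longleftrightarrow>
     (\<exists>\<delta>\<ge>0. \<forall>w\<in>M. \<forall>x\<in>M. \<forall>y\<in>M. \<forall>z\<in>M.
        min (gromov_product d w x y) (gromov_product d w y z) - \<delta> \<le> gromov_product d w x z)"

definition hyperbolic_space :: "'x set \<Rightarrow> ('x \<Rightarrow> 'x \<Rightarrow> real) \<Rightarrow> bool" where
  "hyperbolic_space M d \<longleftrightarrow>
     Metric_space M d \<and> geodesic_space M d \<and> gromov_hyperbolic M d"

definition isometric_action ::
    "('a, 'b) monoid_scheme \<Rightarrow> 'x set \<Rightarrow> ('x \<Rightarrow> 'x \<Rightarrow> real) \<Rightarrow> ('a \<Rightarrow> 'x \<Rightarrow> 'x) \<Rightarrow> bool" where
  "isometric_action G M d \<phi> \<longleftrightarrow>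
     group_action G M \<phi> \<and>
     (\<forall>g\<in>carrier G. \<forall>x\<in>M. \<forall>y\<in>M. d (\<phi> g x) (\<phi> g y) = d x y)"

definition quasi_isometric_embedding ::
    "'y set \<Rightarrow> ('y \<Rightarrow> 'y \<Rightarrow> real) \<Rightarrow> 'x set \<Rightarrow> ('x \<Rightarrow> 'x \<Rightarrow> real) \<Rightarrow> ('y \<Rightarrow> 'x) \<Rightarrow> bool" where
  "quasi_isometric_embedding N e M d f \<longleftrightarrow>
     f ` N \<subseteq> M \<and>
     (\<exists>K\<ge>1. \<exists>C\<ge>0. \<forall>x\<in>N. \<forall>y\<in>N.
        e x y / K - C \<le> d (f x) (f y) \<and> d (f x) (f y) \<le> K * e x y + C)"

definition loxodromic ::
    "('a, 'b) monoid_scheme \<Rightarrow> 'x set \<Rightarrow> ('x \<Rightarrow> 'x \<Rightarrow> real) \<Rightarrow> ('a \<Rightarrow> 'x \<Rightarrow> 'x) \<Rightarrow> 'a \<Rightarrow> bool" where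
  "loxodromic G M d \<phi> g \<longleftrightarrow>
     (\<exists>x\<in>M. quasi_isometric_embedding (UNIV :: int set) (\<lambda>m n. \<bar>real_of_int m - real_of_int n\<bar>)
        M d (\<lambda>n. \<phi> (g [^]\<^bsub>G\<^esub> n) x))"

text \<open>A HOL formula cannot quantify over all types, so the spaces range over all hyperbolic
  spaces whose points lie in the type passed as first argument. Quantification over all
  hyperbolic spaces is obtained by leaving that type arbitrary in theorems, except that it must
  be at least as large as the real numbers: over a type too small to carry a copy of the real
  line, the property could hold for lack of spaces.\<close>

definition property_NL :: "'x itself \<Rightarrow> ('a, 'b) monoid_scheme \<Rightarrow> bool" where
  "property_NL _ G \<longleftrightarrow>
     (\<forall>(M :: 'x set) d \<phi>.
        hyperbolic_space M d \<and> isometric_action G M d \<phi> \<longrightarrow>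
        \<not> (\<exists>g\<in>carrier G. loxodromic G M d \<phi> g))"

text \<open>The semidirect product of the integers with a group of order two acting by negation:
  \<open>(n, s)\<close> stands for the isometry \<open>k \<mapsto> n + k\<close> of the integers if \<open>s\<close> is false, and for
  \<open>k \<mapsto> n - k\<close> if \<open>s\<close> is true. Multiplication is composition.\<close>

definition infinite_dihedral_group :: "(int \<times> bool) monoid" where
  "infinite_dihedral_group =
     \<lparr>carrier = UNIV,
      mult = (\<lambda>(m, s) (n, t). (if s then m - n else m + n, s \<noteq> t)),
      one = (0, False)\<rparr>"

lemma group_infinite_dihedral_group: "group infinite_dihedral_group"
proof (rule groupI)
  fix x assume "x \<in> carrier infinite_dihedral_group"
  obtain m s where x: "x = (m, s)" by (cases x)
  show "\<exists>y\<in>carrier infinite_dihedral_group.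
      y \<otimes>\<^bsub>infinite_dihedral_group\<^esub> x = \<one>\<^bsub>infinite_dihedral_group\<^esub>"
    by (rule bexI[of _ "(if s then m else - m, s)"]) (auto simp: x infinite_dihedral_group_def)
qed (auto simp: infinite_dihedral_group_def split: prod.splits)

definition surjects_onto :: "('a, 'b) monoid_scheme \<Rightarrow> ('c, 'd) monoid_scheme \<Rightarrow> bool" where
  "surjects_onto G H \<longleftrightarrow> epi G H \<noteq> {}"

end

theory Submission
  imports Defs
begin

text \<open>
  Both properties of the group are compared with a third one: \<open>G\<close> acts by isometries on the real line
  so that some element acts as a nontrivial translation. Such an action is given by a signed cocycle
  \<open>(\<epsilon>, c)\<close>, where \<open>g\<close> acts as \<open>t \<mapsto> c g + \<epsilon> g * t\<close> with \<open>\<epsilon> g\<close> equal to \<open>1\<close> or \<open>- 1\<close>.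

  A surjection onto the integers or onto the infinite dihedral group is such a cocycle with integral
  values, and the line is a hyperbolic space on which nontrivial translations are loxodromic
  (\<open>not_property_NL_if_signed_cocycle\<close>). In the other direction, for a finitely generated group a real cocycle
  can be made integral by a rational linear functional, and the image in the infinite dihedral group
  is then infinite, hence isomorphic to the integers or to the dihedral group itself
  (\<open>signed_cocycle_real_imp_int\<close>, \<open>signed_cocycle_int_imp_surjects\<close>).

  The heart of the matter is to extract a cocycle from a loxodromic element of an amenable group
  (\<open>signed_cocycle_if_amenable_loxodromic\<close>). Use the invariant mean as a finitely additive
  probability measure on an orbit. Most of the space moves off under a loxodromic element \<open>a\<close>: a set of
  points that stays away from the two ends of the axis of \<open>a\<close> has infinitely many pairwise disjoint
  translates of the same measure, so it is null. Hence the mean is concentrated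
  at the two ends (\<open>almost_all_deep\<close>). The average of the
  functions \<open>d x o - d x (h o)\<close> over the orbit points \<open>x\<close> is exactly additive in \<open>h\<close>, because the mean is invariant, and
  at \<open>a\<close> it is the translation length of \<open>a\<close> times the difference of the weights of the two ends. If
  the weights differ, this is a nonzero homomorphism to the reals. If they agree, comparison with the
  axes of the conjugates of \<open>a\<close> shows that every group element preserves or swaps the two ends
  (\<open>end_sign_equivariant\<close>), and the average with the opposite sign at one of the ends is a
  signed cocycle that does not vanish at the powers of \<open>a\<close> of large even exponent.

  The ends are never constructed as points of a boundary: being near an end is expressed by the
  distances to the endpoints of a long segment of the axis, which the four-point inequality controls.
\<close>

section \<open>Signed cocycles and dihedral quotients\<close>

text \<open>The pair encodes the homomorphism \<open>g \<mapsto> (t \<mapsto> c g + \<epsilon> g * t)\<close> from \<open>G\<close> to the affine maps with linear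
part \<open>1\<close> or \<open>- 1\<close>. Over the reals these maps are the isometries of the line, over the integers
they form the infinite dihedral group. Keeping the sign \<open>\<epsilon>\<close> integral lets the values of
\<open>c\<close> move between the reals, the rationals and the integers while \<open>\<epsilon>\<close> stays fixed.\<close>

definition signed_cocycle ::
    "('a, 'b) monoid_scheme \<Rightarrow> ('a \<Rightarrow> int) \<Rightarrow> ('a \<Rightarrow> 'r::ring_1) \<Rightarrow> bool" where
  "signed_cocycle G \<epsilon> c \<longleftrightarrow>
     (\<forall>g\<in>carrier G. \<epsilon> g = 1 \<or> \<epsilon> g = - 1) \<and>
     (\<forall>g\<in>carrier G. \<forall>h\<in>carrier G.
        \<epsilon> (g \<otimes>\<^bsub>G\<^esub> h) = \<epsilon> g * \<epsilon> h \<and> c (g \<otimes>\<^bsub>G\<^esub> h) = c g + of_int (\<epsilon> g) * c h)"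

lemma signed_cocycle_sign:
  assumes "signed_cocycle G \<epsilon> c" "g \<in> carrier G"
  shows "\<epsilon> g = 1 \<or> \<epsilon> g = - 1"
  using assms unfolding signed_cocycle_def by blast

lemma signed_cocycle_mult:
  assumes "signed_cocycle G \<epsilon> c" "g \<in> carrier G" "h \<in> carrier G"
  shows "\<epsilon> (g \<otimes>\<^bsub>G\<^esub> h) = \<epsilon> g * \<epsilon> h"
    and "c (g \<otimes>\<^bsub>G\<^esub> h) = c g + of_int (\<epsilon> g) * c h"
  using assms unfolding signed_cocycle_def by blast+

lemma (in group) signed_cocycle_one:
  assumes "signed_cocycle G \<epsilon> c"
  shows "\<epsilon> \<one> = 1" and "c \<one> = 0"
proof -
  show e: "\<epsilon> \<one> = 1"
    using signed_cocycle_mult(1)[OF assms, of \<one> \<one>] signed_cocycle_sign[OF assms one_closed] by auto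
  show "c \<one> = 0"
    using signed_cocycle_mult(2)[OF assms, of \<one> \<one>] e by simp
qed

lemma (in group) signed_cocycle_inv:
  assumes "signed_cocycle G \<epsilon> c" and g: "g \<in> carrier G"
  shows "\<epsilon> (inv g) = \<epsilon> g" and "c (inv g) = - (of_int (\<epsilon> g) * c g)"
proof -
  have "\<epsilon> (inv g) * \<epsilon> g = 1"
    using signed_cocycle_mult(1)[OF assms(1), of "inv g" g] g signed_cocycle_one(1)[OF assms(1)]
    by simp
  then show e: "\<epsilon> (inv g) = \<epsilon> g"
    using signed_cocycle_sign[OF assms] by auto
  show "c (inv g) = - (of_int (\<epsilon> g) * c g)"
    using signed_cocycle_mult(2)[OF assms(1), of "inv g" g] g signed_cocycle_one(2)[OF assms(1)] e
    by (simp add: eq_neg_iff_add_eq_0)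
qed

lemma (in group) signed_cocycle_nat_pow:
  assumes c: "signed_cocycle G \<epsilon> c" and g: "g \<in> carrier G" and e: "\<epsilon> g = 1"
  shows "\<epsilon> (g [^] (n::nat)) = 1" and "c (g [^] n) = of_nat n * c g"
proof (induction n)
  case 0
  { case 1 show ?case using signed_cocycle_one[OF c] by simp }
  { case 2 show ?case using signed_cocycle_one[OF c] by simp }
next
  case (Suc n)
  { case 1 show ?case using Suc signed_cocycle_mult[OF c, of "g [^] n" g] g e by simp }
  { case 2 show ?case using Suc signed_cocycle_mult[OF c, of "g [^] n" g] g
      by (simp add: algebra_simps) }
qed

lemma (in group) signed_cocycle_int_pow:
  fixes c :: "'a \<Rightarrow> 'r::ring_1"
  assumes c: "signed_cocycle G \<epsilon> c" and g: "g \<in> carrier G" and e: "\<epsilon> g = 1"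
  shows "\<epsilon> (g [^] (n::int)) = 1" and "c (g [^] n) = of_int n * c g"
proof -
  have "\<epsilon> (g [^] n) = 1 \<and> c (g [^] n) = of_int n * c g"
  proof (cases "n \<ge> 0")
    case True
    then have "n = int (nat n)" by simp
    then show ?thesis
      using signed_cocycle_nat_pow[OF assms, of "nat n"] by (metis int_pow_int of_int_of_nat_eq)
  next
    case False
    define m where "m = nat (- n)"
    have n: "n = - int m" using False by (simp add: m_def)
    have "g [^] n = inv (g [^] m)" by (simp add: n int_pow_neg_int g)
    then show ?thesis
      using signed_cocycle_nat_pow[OF assms, of m] signed_cocycle_inv[OF c, of "g [^] m"] g
      by (simp add: n)
  qed
  then show "\<epsilon> (g [^] n) = 1" and "c (g [^] n) = of_int n * c g" by auto
qed

text \<open>The reals are a vector space over the rationals, so a nonzero real extends to a Hamel basis.\<close>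

lemma exists_additive_rational_functional:
  fixes r :: real
  assumes "r \<noteq> 0"
  obtains f :: "real \<Rightarrow> rat"
    where "\<And>x y. f (x + y) = f x + f y" and "\<And>x. f (- x) = - f x" and "f r = 1"
proof -
  interpret Q: vector_space_pair "\<lambda>q (x::real). of_rat q * x" "\<lambda>q (x::rat). q * x"
    by unfold_locales (auto simp: algebra_simps of_rat_add of_rat_mult)
  have "Q.vs1.independent {r}"
    using assms by simp
  then obtain f where lin: "Vector_Spaces.linear (\<lambda>q (x::real). of_rat q * x) (\<lambda>q x. q * x) f"
      and f: "\<forall>x\<in>{r}. f x = (1::rat)"
    using Q.linear_independent_extend[of "{r}" "\<lambda>_. 1"] by blast
  interpret f: Vector_Spaces.linear "\<lambda>q (x::real). of_rat q * x" "\<lambda>q x. q * x" f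
    by (rule lin)
  show thesis
    using f by (intro that[of f]) (auto simp: f.add f.neg)
qed

lemma common_denominator:
  assumes "finite (A :: rat set)"
  obtains q :: int where "q > 0" "\<And>x. x \<in> A \<Longrightarrow> of_int q * x \<in> \<int>"
proof -
  have "\<exists>q::int. q > 0 \<and> (\<forall>x\<in>A. of_int q * x \<in> \<int>)"
    using assms
  proof (induction A)
    case empty
    show ?case by (rule exI[of _ 1]) auto
  next
    case (insert y A)
    then obtain q :: int where q: "q > 0" "\<forall>x\<in>A. of_int q * x \<in> \<int>" by blast
    obtain a b where ab: "quotient_of y = (a, b)" by fastforce
    have b: "b > 0" using ab by (rule quotient_of_denom_pos)
    have y: "of_int b * y = of_int a"
      using quotient_of_div[OF ab] b by simp
    show ?case
    proof (intro exI[of _ "q * b"] conjI ballI)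
      show "q * b > 0" using q b by simp
      fix x assume "x \<in> insert y A"
      then show "of_int (q * b) * x \<in> \<int>"
      proof (elim insertE)
        assume "x = y"
        then have "of_int (q * b) * x = of_int (q * a)"
          using y by (simp add: mult.assoc)
        then show ?thesis by (metis Ints_of_int)
      next
        assume "x \<in> A"
        then have "of_int b * (of_int q * x) \<in> \<int>" using q by (blast intro: Ints_mult[OF Ints_of_int])
        then show ?thesis by (simp add: mult_ac)
      qed
    qed
  qed
  then show thesis using that by blast
qed

text \<open>An additive map \<open>real \<Rightarrow> rat\<close> carries a real cocycle to a rational one with the same sign and can
be chosen not to kill the value at \<open>b\<close>. The values on a finite generating set have a common
denominator \<open>q\<close>, and the elements at which \<open>q\<close> times the cocycle is integral form a subgroup, so \<open>q\<close>
clears the denominators everywhere.\<close>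

lemma (in group) signed_cocycle_real_imp_int:
  fixes c :: "'a \<Rightarrow> real"
  assumes fg: "finitely_generated_group G" and c: "signed_cocycle G \<epsilon> c"
    and b: "b \<in> carrier G" "c b \<noteq> 0"
  obtains c' :: "'a \<Rightarrow> int" where "signed_cocycle G \<epsilon> c'" "c' b \<noteq> 0"
proof -
  obtain S where S: "finite S" "S \<subseteq> carrier G" "generate G S = carrier G"
    using fg unfolding finitely_generated_group_def by blast
  obtain f :: "real \<Rightarrow> rat" where f: "\<And>x y. f (x + y) = f x + f y" "\<And>x. f (- x) = - f x"
      "f (c b) = 1"
    using exists_additive_rational_functional[OF b(2)] by blast
  have fdiff: "f (x - y) = f x - f y" for x y
    using f(1)[of x "- y"] f(2) by simp
  obtain q :: int where q: "q > 0" "\<And>x. x \<in> f ` c ` S \<Longrightarrow> of_int q * x \<in> \<int>"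
    using common_denominator[of "f ` c ` S"] S(1) by blast
  define e where "e g = of_int q * f (c g)" for g
  have e: "signed_cocycle G \<epsilon> e"
    unfolding signed_cocycle_def
  proof (intro conjI ballI)
    fix g assume g: "g \<in> carrier G"
    show "\<epsilon> g = 1 \<or> \<epsilon> g = - 1" by (rule signed_cocycle_sign[OF c g])
    fix h assume h: "h \<in> carrier G"
    show "\<epsilon> (g \<otimes> h) = \<epsilon> g * \<epsilon> h" by (rule signed_cocycle_mult[OF c g h])
    show "e (g \<otimes> h) = e g + of_int (\<epsilon> g) * e h"
      using signed_cocycle_sign[OF c g]
      by (auto simp: e_def signed_cocycle_mult[OF c g h] fdiff f(1,2) algebra_simps)
  qed
  have int: "e g \<in> \<int>" if "g \<in> carrier G" for g
    using that unfolding S(3)[symmetric]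
  proof (induction rule: generate.induct)
    case one
    show ?case using signed_cocycle_one[OF e] by simp
  next
    case (incl h)
    then show ?case using q by (auto simp: e_def)
  next
    case (inv h)
    then have "e h \<in> \<int>" using q by (auto simp: e_def)
    moreover have "e (inv h) = - (of_int (\<epsilon> h) * e h)"
      using inv S by (intro signed_cocycle_inv[OF e]) auto
    ultimately show ?case by simp
  next
    case (eng g h)
    then have "e (g \<otimes> h) = e g + of_int (\<epsilon> g) * e h"
      by (intro signed_cocycle_mult[OF e]) (auto simp: S)
    then show ?case using eng by simp
  qed
  define c' where "c' g = \<lfloor>e g\<rfloor>" for g
  have c': "of_int (c' g) = e g" if "g \<in> carrier G" for g
    using int[OF that] by (simp add: c'_def)
  show thesis
  proof
    show "signed_cocycle G \<epsilon> c'"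
      unfolding signed_cocycle_def
    proof (intro conjI ballI)
      fix g assume g: "g \<in> carrier G"
      show "\<epsilon> g = 1 \<or> \<epsilon> g = - 1" by (rule signed_cocycle_sign[OF c g])
      fix h assume h: "h \<in> carrier G"
      show "\<epsilon> (g \<otimes> h) = \<epsilon> g * \<epsilon> h" by (rule signed_cocycle_mult[OF c g h])
      have "(of_int (c' (g \<otimes> h)) :: rat) = of_int (c' g + \<epsilon> g * c' h)"
        using signed_cocycle_mult(2)[OF e g h] g h by (simp add: c')
      then show "c' (g \<otimes> h) = c' g + of_int (\<epsilon> g) * c' h"
        unfolding of_int_eq_iff by simp
    qed
    show "c' b \<noteq> 0"
      using c'[OF b(1)] f(3) q(1) by (auto simp: e_def)
  qed
qed

text \<open>A homomorphism to the dihedral group whose image contains a translation. The translations in the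
image form a subgroup \<open>d\<int>\<close> with \<open>d > 0\<close>. Without reflections the image is \<open>d\<int>\<close>. With a reflection
at offset \<open>c t\<close>, all reflections have offsets in \<open>c t + d\<int>\<close>; moving the origin of the line to the
centre \<open>c t / 2\<close> of one of them, and then rescaling by \<open>d\<close>, makes the homomorphism onto.\<close>

lemma (in group) signed_cocycle_int_imp_surjects:
  fixes c :: "'a \<Rightarrow> int"
  assumes c: "signed_cocycle G \<epsilon> c" and b: "b \<in> carrier G" "\<epsilon> b = 1" "c b \<noteq> 0"
  shows "surjects_onto G integer_group \<or> surjects_onto G infinite_dihedral_group"
proof -
  define T where "T = {c g | g. g \<in> carrier G \<and> \<epsilon> g = 1}"
  have T0: "0 \<in> T" using signed_cocycle_one[OF c] by (force simp: T_def)
  have Tadd: "x + y \<in> T" if xy: "x \<in> T" "y \<in> T" for x y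
  proof -
    obtain g h where "g \<in> carrier G" "\<epsilon> g = 1" "x = c g" "h \<in> carrier G" "\<epsilon> h = 1" "y = c h"
      using xy by (auto simp: T_def)
    then show ?thesis
      using signed_cocycle_mult[OF c, of g h] by (force simp: T_def intro!: exI[of _ "g \<otimes> h"])
  qed
  have Tneg: "- x \<in> T" if x: "x \<in> T" for x
  proof -
    obtain g where "g \<in> carrier G" "\<epsilon> g = 1" "x = c g"
      using x by (auto simp: T_def)
    then show ?thesis
      using signed_cocycle_inv[OF c, of g] by (force simp: T_def intro!: exI[of _ "inv g"])
  qed
  have Tmult: "k * x \<in> T" if x: "x \<in> T" for k x
    using x T0 Tadd Tneg
    by (induction k rule: int_induct[where k = 0])
      (auto simp: distrib_right left_diff_distrib simp del: add_uminus_conv_diff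
        simp flip: add_uminus_conv_diff)
  define d where "d = (LEAST n::nat. n > 0 \<and> int n \<in> T)"
  have "\<exists>n::nat. n > 0 \<and> int n \<in> T"
    using b Tneg by (intro exI[of _ "nat \<bar>c b\<bar>"]) (auto simp: T_def abs_if)
  then have "d > 0 \<and> int d \<in> T"
    unfolding d_def by (rule LeastI_ex)
  then have d0: "d > 0" and dT: "int d \<in> T" by auto
  have T_iff: "x \<in> T \<longleftrightarrow> int d dvd x" for x
  proof
    assume "int d dvd x"
    then show "x \<in> T" using Tmult[OF dT] by (auto simp: mult.commute elim!: dvdE)
  next
    assume x: "x \<in> T"
    have "x mod int d = x + - (x div int d) * int d"
      by (simp add: minus_div_mult_eq_mod)
    also have "\<dots> \<in> T" by (rule Tadd[OF x Tmult[OF dT]])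
    finally have m: "x mod int d \<in> T" .
    show "int d dvd x"
    proof (rule ccontr)
      assume "\<not> int d dvd x"
      then have "x mod int d > 0"
        using d0 by (metis dvd_eq_mod_eq_0 of_nat_0_less_iff order_le_less pos_mod_sign)
      then have "nat (x mod int d) > 0 \<and> int (nat (x mod int d)) \<in> T"
        using m by simp
      then have "d \<le> nat (x mod int d)"
        unfolding d_def by (rule Least_le)
      then have "int d \<le> x mod int d"
        using \<open>x mod int d > 0\<close> by simp
      moreover have "x mod int d < int d" using d0 by simp
      ultimately show False by simp
    qed
  qed
  show ?thesis
  proof (cases "\<exists>t\<in>carrier G. \<epsilon> t = - 1")
    case False
    then have e1: "\<epsilon> g = 1" if "g \<in> carrier G" for g
      using signed_cocycle_sign[OF c that] that by blast
    have cT: "int d dvd c g" if "g \<in> carrier G" for g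
      using T_iff that e1 by (auto simp: T_def)
    have "(\<lambda>g. c g div int d) \<in> hom G integer_group"
    proof (rule homI)
      fix g h assume "g \<in> carrier G" "h \<in> carrier G"
      then show "c (g \<otimes> h) div int d = (c g div int d) \<otimes>\<^bsub>integer_group\<^esub> (c h div int d)"
        using signed_cocycle_mult(2)[OF c, of g h] e1[of g] cT by (simp add: div_plus_div_distrib_dvd_left)
    qed simp
    moreover have "(\<lambda>g. c g div int d) ` carrier G = UNIV"
    proof (rule UNIV_eq_I[symmetric])
      fix n :: int
      have "n * int d \<in> T" by (rule Tmult[OF dT])
      then obtain g where "g \<in> carrier G" "c g = n * int d" by (auto simp: T_def)
      then show "n \<in> (\<lambda>g. c g div int d) ` carrier G"
        using d0 by (intro image_eqI[of _ _ g]) auto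
    qed
    ultimately show ?thesis unfolding surjects_onto_def epi_def by auto
  next
    case True
    then obtain t where t: "t \<in> carrier G" "\<epsilon> t = - 1" by blast
    \<comment> \<open>Subtracting \<open>r\<close> moves the origin to \<open>c t / 2\<close>: it is the coboundary \<open>(1 - \<epsilon> g) * c t / 2\<close>,
      which is integral although \<open>c t / 2\<close> need not be.\<close>
    define r where "r g = (if \<epsilon> g = 1 then 0 else c t)" for g
    have dvd: "int d dvd c g - r g" if g: "g \<in> carrier G" for g
      using signed_cocycle_sign[OF c g]
    proof
      assume "\<epsilon> g = 1"
      then show ?thesis using T_iff g by (auto simp: T_def r_def)
    next
      assume 2: "\<epsilon> g = - 1"
      have "c (g \<otimes> t) \<in> T"
        using 2 g t signed_cocycle_mult(1)[OF c g t(1)] by (auto simp: T_def)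
      then show ?thesis
        using 2 T_iff signed_cocycle_mult(2)[OF c g t(1)] by (simp add: r_def)
    qed
    define f where "f g = ((c g - r g) div int d, \<epsilon> g \<noteq> 1)" for g
    have "f \<in> hom G infinite_dihedral_group"
    proof (rule homI)
      fix g h assume g: "g \<in> carrier G" and h: "h \<in> carrier G"
      have "c (g \<otimes> h) - r (g \<otimes> h) = (c g - r g) + \<epsilon> g * (c h - r h)"
        using signed_cocycle_sign[OF c g] signed_cocycle_sign[OF c h] signed_cocycle_mult[OF c g h]
        by (auto simp: r_def)
      moreover obtain m n where "c g - r g = int d * m" "c h - r h = int d * n"
        using dvd[OF g] dvd[OF h] by (auto elim!: dvdE)
      moreover have "int d * m + \<epsilon> g * (int d * n) = int d * (m + \<epsilon> g * n)" for m n
        by (simp add: algebra_simps)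
      ultimately show "f (g \<otimes> h) = f g \<otimes>\<^bsub>infinite_dihedral_group\<^esub> f h"
        using signed_cocycle_sign[OF c g] signed_cocycle_sign[OF c h] signed_cocycle_mult(1)[OF c g h] d0
        by (auto simp: f_def infinite_dihedral_group_def)
    qed (simp add: infinite_dihedral_group_def)
    moreover have "f ` carrier G = UNIV"
    proof (rule UNIV_eq_I[symmetric])
      fix z :: "int \<times> bool"
      obtain n s where z: "z = (n, s)" by (cases z)
      have "n * int d \<in> T" by (rule Tmult[OF dT])
      then obtain g where g: "g \<in> carrier G" "\<epsilon> g = 1" "c g = n * int d" by (auto simp: T_def)
      show "z \<in> f ` carrier G"
      proof (cases s)
        case False
        then show ?thesis
          using g d0 z by (intro image_eqI[of _ _ g]) (auto simp: f_def r_def)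
      next
        case True
        then show ?thesis
          using g t d0 z signed_cocycle_mult[OF c g(1) t(1)]
          by (intro image_eqI[of _ _ "g \<otimes> t"]) (auto simp: f_def r_def)
      qed
    qed
    ultimately show ?thesis unfolding surjects_onto_def epi_def by (auto simp: infinite_dihedral_group_def)
  qed
qed

section \<open>Isometric actions on the real line\<close>

text \<open>The cocycle lets \<open>G\<close> act on the real line by isometries, and \<open>b\<close> acts as the translation by
\<open>c b \<noteq> 0\<close>, which is loxodromic. The line is copied into the type \<open>'x\<close> along an injection.\<close>

lemma (in group) not_property_NL_if_signed_cocycle:
  fixes c :: "'a \<Rightarrow> real"
  assumes c: "signed_cocycle G \<epsilon> c" and b: "b \<in> carrier G" "\<epsilon> b = 1" "c b \<noteq> 0"
    and large: "(UNIV :: real set) \<lesssim> (UNIV :: 'x set)"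
  shows "\<not> property_NL TYPE('x) G"
proof -
  obtain \<iota> :: "real \<Rightarrow> 'x" where inj: "inj \<iota>"
    using large by (auto simp: lepoll_def)
  define pos where "pos = inv_into UNIV \<iota>"
  define M where "M = range \<iota>"
  define d where "d x y = \<bar>pos x - pos y\<bar>" for x y
  define \<phi> where "\<phi> g = (\<lambda>x\<in>M. \<iota> (c g + of_int (\<epsilon> g) * pos x))" for g
  have pos [simp]: "pos (\<iota> t) = t" for t
    by (simp add: pos_def inj)
  have \<iota>M [simp]: "\<iota> t \<in> M" for t
    by (simp add: M_def)
  have \<phi> [simp]: "\<phi> g (\<iota> t) = \<iota> (c g + of_int (\<epsilon> g) * t)" for g t
    by (simp add: \<phi>_def)
  have "Metric_space M d"
    by unfold_locales (auto simp: d_def M_def)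
  moreover have "geodesic_space M d"
    unfolding geodesic_space_def
  proof (intro ballI)
    fix x y assume "x \<in> M" "y \<in> M"
    then obtain s t where st: "x = \<iota> s" "y = \<iota> t" by (auto simp: M_def)
    show "\<exists>\<gamma> :: real \<Rightarrow> 'x. \<gamma> 0 = x \<and> \<gamma> (d x y) = y \<and> \<gamma> ` {0..d x y} \<subseteq> M \<and>
        (\<forall>r\<in>{0..d x y}. \<forall>r'\<in>{0..d x y}. d (\<gamma> r) (\<gamma> r') = \<bar>r - r'\<bar>)"
      by (rule exI[of _ "\<lambda>r. \<iota> (if s \<le> t then s + r else s - r)"]) (auto simp: st d_def)
  qed
  moreover have "gromov_hyperbolic M d"
    unfolding gromov_hyperbolic_def gromov_product_def
  proof (intro exI[of _ 0] conjI ballI)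
    have "min ((\<bar>x - w\<bar> + \<bar>y - w\<bar> - \<bar>x - y\<bar>) / 2) ((\<bar>y - w\<bar> + \<bar>z - w\<bar> - \<bar>y - z\<bar>) / 2) - 0
        \<le> (\<bar>x - w\<bar> + \<bar>z - w\<bar> - \<bar>x - z\<bar>) / 2" for w x y z :: real
      unfolding min_def by (simp split: abs_split)
    then show "min ((d x w + d y w - d x y) / 2) ((d y w + d z w - d y z) / 2) - 0
        \<le> (d x w + d z w - d x z) / 2" for w x y z
      unfolding d_def by blast
  qed simp
  moreover have "isometric_action G M d \<phi>"
  proof -
    have bij: "\<phi> g \<in> Bij M" if g: "g \<in> carrier G" for g
    proof -
      have e: "of_int (\<epsilon> g) * of_int (\<epsilon> g) = (1::real)"
        using signed_cocycle_sign[OF c g] by auto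
      have "bij_betw (\<phi> g) M M"
      proof (rule bij_betwI[where g = "\<lambda>x. \<iota> (of_int (\<epsilon> g) * (pos x - c g))"])
        show "\<phi> g \<in> M \<rightarrow> M" by (auto simp: M_def)
        show "(\<lambda>x. \<iota> (of_int (\<epsilon> g) * (pos x - c g))) \<in> M \<rightarrow> M" by auto
      qed (auto simp: M_def e mult.assoc[symmetric])
      then show ?thesis by (auto simp: Bij_def \<phi>_def)
    qed
    have "\<phi> \<in> hom G (BijGroup M)"
    proof (rule homI)
      fix g h assume g: "g \<in> carrier G" and h: "h \<in> carrier G"
      show "\<phi> (g \<otimes> h) = \<phi> g \<otimes>\<^bsub>BijGroup M\<^esub> \<phi> h"
      proof
        fix x
        show "\<phi> (g \<otimes> h) x = (\<phi> g \<otimes>\<^bsub>BijGroup M\<^esub> \<phi> h) x"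
        proof (cases "x \<in> M")
          case True
          then obtain t where "x = \<iota> t" by (auto simp: M_def)
          then show ?thesis
            using signed_cocycle_mult[OF c g h] bij[OF g] bij[OF h]
            by (simp add: BijGroup_def compose_eq algebra_simps)
        next
          case False
          then show ?thesis
            using bij[OF g] bij[OF h] by (simp add: BijGroup_def \<phi>_def compose_def)
        qed
      qed
    qed (simp add: bij BijGroup_def)
    then have "group_action G M \<phi>"
      by (simp add: group_action_def group_hom_def group_hom_axioms_def group_BijGroup is_group)
    moreover have "d (\<phi> g x) (\<phi> g y) = d x y"
      if g: "g \<in> carrier G" and "x \<in> M" "y \<in> M" for g x y
      using that signed_cocycle_sign[OF c g] by (auto simp: M_def d_def)
    ultimately show ?thesis by (simp add: isometric_action_def)
  qed
  moreover have "loxodromic G M d \<phi> b"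
    unfolding loxodromic_def
  proof (rule bexI[of _ "\<iota> 0"])
    define r where "r = \<bar>c b\<bar>"
    have r: "r > 0" using b by (simp add: r_def)
    have dist: "d (\<phi> (b [^] (m::int)) (\<iota> 0)) (\<phi> (b [^] (n::int)) (\<iota> 0)) = r * \<bar>real_of_int m - real_of_int n\<bar>"
      for m n
      by (simp add: d_def signed_cocycle_int_pow[OF c b(1,2)] r_def flip: left_diff_distrib abs_mult)
        (simp add: mult.commute)
    \<comment> \<open>Both \<open>r\<close> and its inverse must be at most \<open>K\<close>.\<close>
    define K where "K = r + 1 / r + 1"
    have K: "K \<ge> 1" "r \<le> K" "1 / K \<le> r"
    proof -
      show "K \<ge> 1" "r \<le> K" using r by (auto simp: K_def)
      have "1 / r \<le> K" using r by (simp add: K_def)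
      then show "1 / K \<le> r" using r \<open>K \<ge> 1\<close> by (simp add: field_simps)
    qed
    show "quasi_isometric_embedding UNIV (\<lambda>m n. \<bar>real_of_int m - real_of_int n\<bar>) M d
        (\<lambda>n. \<phi> (b [^] n) (\<iota> 0))"
      unfolding quasi_isometric_embedding_def
    proof (intro conjI)
      show "(\<lambda>n. \<phi> (b [^] n) (\<iota> 0)) ` UNIV \<subseteq> M" by auto
    next
      show "\<exists>K\<ge>1. \<exists>C\<ge>0. \<forall>m\<in>UNIV. \<forall>n\<in>UNIV.
          \<bar>real_of_int m - real_of_int n\<bar> / K - C \<le> d (\<phi> (b [^] m) (\<iota> 0)) (\<phi> (b [^] n) (\<iota> 0)) \<and>
          d (\<phi> (b [^] m) (\<iota> 0)) (\<phi> (b [^] n) (\<iota> 0)) \<le> K * \<bar>real_of_int m - real_of_int n\<bar> + C"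
      proof (rule exI[of _ K], intro conjI, rule K, rule exI[of _ 0], intro conjI ballI)
        fix m n :: int
        show "\<bar>real_of_int m - real_of_int n\<bar> / K - 0 \<le> d (\<phi> (b [^] m) (\<iota> 0)) (\<phi> (b [^] n) (\<iota> 0))"
          using mult_right_mono[OF K(3), of "\<bar>real_of_int m - real_of_int n\<bar>"]
          unfolding dist by simp
        show "d (\<phi> (b [^] m) (\<iota> 0)) (\<phi> (b [^] n) (\<iota> 0)) \<le> K * \<bar>real_of_int m - real_of_int n\<bar> + 0"
          using mult_right_mono[OF K(2), of "\<bar>real_of_int m - real_of_int n\<bar>"]
          unfolding dist by simp
      qed simp
    qed
  qed simp
  ultimately show ?thesis
    using b(1) unfolding property_NL_def hyperbolic_space_def by blast
qed

lemma signed_cocycle_if_surjects_onto_integers: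
  assumes "surjects_onto G integer_group"
  obtains c :: "'a \<Rightarrow> real" and b
    where "signed_cocycle G (\<lambda>_. 1) c" "b \<in> carrier G" "c b \<noteq> 0"
proof -
  obtain f where f: "f \<in> hom G integer_group" "f ` carrier G = UNIV"
    using assms unfolding surjects_onto_def epi_def by auto
  then obtain b where "b \<in> carrier G" "f b = 1" by (metis UNIV_I imageE)
  then show thesis
    using hom_mult[OF f(1)]
    by (intro that[of "\<lambda>g. of_int (f g)" b]) (auto simp: signed_cocycle_def)
qed

lemma signed_cocycle_if_surjects_onto_dihedral:
  assumes "surjects_onto G infinite_dihedral_group"
  obtains \<epsilon> and c :: "'a \<Rightarrow> real" and b
    where "signed_cocycle G \<epsilon> c" "b \<in> carrier G" "\<epsilon> b = 1" "c b \<noteq> 0"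
proof -
  obtain f where f: "f \<in> hom G infinite_dihedral_group" "f ` carrier G = UNIV"
    using assms unfolding surjects_onto_def epi_def by (auto simp: infinite_dihedral_group_def)
  then obtain b where b: "b \<in> carrier G" "f b = (1, False)" by (metis UNIV_I imageE)
  define \<epsilon> c where "\<epsilon> g = (if snd (f g) then - 1 else 1 :: int)" and "c g = real_of_int (fst (f g))"
    for g
  have "signed_cocycle G \<epsilon> c"
    unfolding signed_cocycle_def
  proof (intro conjI ballI)
    fix g h assume g: "g \<in> carrier G" and h: "h \<in> carrier G"
    obtain m s n t where "f g = (m, s)" "f h = (n, t)" by (cases "f g", cases "f h") auto
    then show "\<epsilon> (g \<otimes>\<^bsub>G\<^esub> h) = \<epsilon> g * \<epsilon> h" "c (g \<otimes>\<^bsub>G\<^esub> h) = c g + of_int (\<epsilon> g) * c h"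
      using hom_mult[OF f(1) g h] by (auto simp: \<epsilon>_def c_def infinite_dihedral_group_def)
  qed (simp add: \<epsilon>_def)
  then show thesis using b by (intro that[of \<epsilon> c b]) (auto simp: \<epsilon>_def c_def)
qed

section \<open>Axes in hyperbolic spaces\<close>

text \<open>Among the three sums of opposite distances between four points, the two largest differ by at most
\<open>2 * \<delta>\<close>. This symmetric form has no base point, so it can be applied along a sequence.\<close>

lemma gromov_hyperbolic_four_point:
  assumes "Metric_space M d" "gromov_hyperbolic M d"
  obtains \<delta> where "\<delta> \<ge> 0"
    and "\<And>w x y z. \<lbrakk>w \<in> M; x \<in> M; y \<in> M; z \<in> M\<rbrakk> \<Longrightarrow>
           d x z + d y w \<le> max (d x y + d z w) (d x w + d y z) + 2 * \<delta>"
proof -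
  interpret Metric_space M d by fact
  obtain \<delta> where \<delta>: "\<delta> \<ge> 0" "\<forall>w\<in>M. \<forall>x\<in>M. \<forall>y\<in>M. \<forall>z\<in>M.
      min (gromov_product d w x y) (gromov_product d w y z) - \<delta> \<le> gromov_product d w x z"
    using assms(2) unfolding gromov_hyperbolic_def by blast
  show thesis
  proof (rule that[OF \<delta>(1)])
    fix w x y z assume "w \<in> M" "x \<in> M" "y \<in> M" "z \<in> M"
    then have "min (gromov_product d w x y) (gromov_product d w y z) - \<delta> \<le> gromov_product d w x z"
      using \<delta>(2) by blast
    then show "d x z + d y w \<le> max (d x y + d z w) (d x w + d y z) + 2 * \<delta>"
      by (auto simp: gromov_product_def min_def max_def field_simps split: if_splits)
  qed
qed

text \<open>The sequence \<open>p\<close> stands for an orbit of a cyclic group of isometries, so the distance of two of its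
points depends on the difference of their indices only. The condition on \<open>L 2\<close> says that the
sequence makes definite progress at the scale of \<open>\<delta>\<close>; it forces \<open>p\<close> to be a quasi-geodesic
for which the additive errors below do not grow with the length.\<close>

locale hyperbolic_axis = Metric_space M d for M :: "'x set" and d +
  fixes \<delta> :: real and p :: "int \<Rightarrow> 'x" and L :: "nat \<Rightarrow> real"
  assumes delta_nonneg: "\<delta> \<ge> 0"
    and four_point: "\<And>w x y z. \<lbrakk>w \<in> M; x \<in> M; y \<in> M; z \<in> M\<rbrakk> \<Longrightarrow>
           d x z + d y w \<le> max (d x y + d z w) (d x w + d y z) + 2 * \<delta>"
    and axis_in: "p i \<in> M"
    and axis_dist: "d (p i) (p j) = L (nat \<bar>i - j\<bar>)"
    and gap: "L 1 + 4 * \<delta> + 1 \<le> L 2"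
begin

lemma reflect: "hyperbolic_axis M d \<delta> (\<lambda>i. p (- i)) L"
  by unfold_locales
    (use delta_nonneg gap four_point in \<open>simp_all add: axis_in axis_dist abs_minus_commute\<close>)

lemma axis_dist_le: "i \<le> j \<Longrightarrow> d (p i) (p j) = L (nat (j - i))"
  unfolding axis_dist by (rule arg_cong[of _ _ L]) auto

lemma axis_triangle:
  assumes "x \<in> M"
  shows "d x (p i) \<le> d x (p j) + L (nat \<bar>i - j\<bar>)"
proof -
  have "d x (p i) \<le> d x (p j) + d (p j) (p i)"
    by (intro triangle assms axis_in)
  then show ?thesis by (simp add: axis_dist abs_minus_commute)
qed

lemma L_0: "L 0 = 0"
  using axis_dist[of 0 0] mdist_zero[OF axis_in[of 0]] by simp

lemma L_subadd: "L (m + n) \<le> L m + L n"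
  using axis_triangle[OF axis_in, of 0 "int (m + n)" "int m"]
  by (simp add: axis_dist nat_add_distrib add.commute)

lemma L_1: "L 1 \<ge> 4 * \<delta> + 1"
  using L_subadd[of 1 1] gap unfolding one_add_one by linarith

text \<open>The four-point condition for \<open>p 0\<close>, \<open>p n\<close>, \<open>p (n + 1)\<close>, \<open>p (n + 2)\<close>: the sum \<open>L (n + 1) + L 2\<close>
exceeds \<open>L n + L 1\<close> by more than \<open>2 * \<delta>\<close>, so it is bounded by the remaining sum
\<open>L (n + 2) + L 1\<close> up to \<open>2 * \<delta>\<close>.\<close>

lemma L_step: "L n + 2 * \<delta> + 1 \<le> L (Suc n)"
proof (induction n)
  case 0
  show ?case using L_0 L_1 delta_nonneg by simp
next
  case (Suc n)
  have "d (p 0) (p (int (Suc n))) + d (p (int n)) (p (int (Suc (Suc n)))) \<le>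
      max (d (p 0) (p (int n)) + d (p (int (Suc n))) (p (int (Suc (Suc n)))))
          (d (p 0) (p (int (Suc (Suc n)))) + d (p (int n)) (p (int (Suc n)))) + 2 * \<delta>"
    by (intro four_point axis_in)
  moreover have "nat \<bar>0 - int m\<bar> = m" "nat \<bar>int m - int (Suc m)\<bar> = 1"
      "nat \<bar>int m - int (Suc (Suc m))\<bar> = 2" for m
    by auto
  ultimately have "L (Suc n) + L 2 \<le> max (L n + L 1) (L (Suc (Suc n)) + L 1) + 2 * \<delta>"
    by (simp only: axis_dist)
  then show ?case using Suc.IH gap delta_nonneg by simp
qed

lemma L_ge: "real n \<le> L n"
proof (induction n)
  case (Suc n)
  then show ?case using L_step[of n] delta_nonneg by simp
qed (simp add: L_0)

lemma L_mono: "m \<le> n \<Longrightarrow> L m \<le> L n"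
  by (rule lift_Suc_mono_le[of L]) (use L_step delta_nonneg in \<open>smt (verit)\<close>)

text \<open>Lengths along the axis are additive up to a constant: the four-point condition for
\<open>p (- m)\<close>, \<open>p 0\<close>, \<open>p 1\<close>, \<open>p n\<close>. In terms of Gromov products, \<open>p 0\<close> is within a bounded error
of lying between \<open>p (- m)\<close> and \<open>p n\<close>.\<close>

lemma L_superadd: "L m + L n \<le> L (m + n) + L 1"
proof (cases n)
  case 0
  then show ?thesis using L_0 L_1 delta_nonneg by simp
next
  case (Suc k)
  have "d (p (- int m)) (p 1) + d (p 0) (p (int n)) \<le>
      max (d (p (- int m)) (p 0) + d (p 1) (p (int n)))
          (d (p (- int m)) (p (int n)) + d (p 0) (p 1)) + 2 * \<delta>"
    by (intro four_point axis_in)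
  moreover have "nat \<bar>- int m - 1\<bar> = Suc m" "nat \<bar>0 - int n\<bar> = n" "nat \<bar>- int m - 0\<bar> = m"
      "nat \<bar>1 - int n\<bar> = k" "nat \<bar>- int m - int n\<bar> = m + n" "nat \<bar>0 - 1 :: int\<bar> = 1"
    using Suc by auto
  ultimately have "L (Suc m) + L n \<le> max (L m + L k) (L (m + n) + L 1) + 2 * \<delta>"
    by (simp only: axis_dist)
  then show ?thesis
    using L_step[of m] L_step[of k] Suc delta_nonneg by simp
qed

definition D :: real where "D = L 1 + 2 * \<delta>"

lemma D_nonneg: "D \<ge> 0"
  using L_1 delta_nonneg by (simp add: D_def)

text \<open>The distance to a point, as a function along the axis, has at most one valley: from every index it
grows at almost full speed in at least one of the two directions.\<close>

lemma valley:
  assumes x: "x \<in> M" and "i \<le> j" "j \<le> k"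
  shows "d x (p j) + L (nat (j - i)) - D \<le> d x (p i) \<or> d x (p j) + L (nat (k - j)) - D \<le> d x (p k)"
proof -
  have "nat (j - i) + nat (k - j) = nat (k - i)" using assms by simp
  then have "L (nat (j - i)) + L (nat (k - j)) \<le> d (p i) (p k) + L 1"
    using L_superadd[of "nat (j - i)" "nat (k - j)"] assms by (simp add: axis_dist_le)
  moreover have "d x (p j) + d (p i) (p k) \<le>
      max (d x (p i) + d (p j) (p k)) (d x (p k) + d (p i) (p j)) + 2 * \<delta>"
    by (intro four_point x axis_in)
  ultimately show ?thesis using assms by (simp add: axis_dist_le D_def max_def split: if_splits)
qed

text \<open>A window \<open>[i, j]\<close> is flat for \<open>x\<close> if the distance to \<open>x\<close> changes across it by less than its
length minus \<open>D\<close>. If the first window is flat, the distance grows from \<open>j\<close> to \<open>k\<close>; if the second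
one is flat, it grows from \<open>k\<close> to \<open>j\<close>. Both can only happen if the windows are close.\<close>

lemma flat_windows_close:
  assumes x: "x \<in> M" and "i \<le> j" "j \<le> k" "k \<le> l"
    and "\<bar>d x (p i) - d x (p j)\<bar> < L (nat (j - i)) - D"
    and "\<bar>d x (p k) - d x (p l)\<bar> < L (nat (l - k)) - D"
  shows "L (nat (k - j)) \<le> D"
proof -
  have "d x (p j) + L (nat (k - j)) - D \<le> d x (p k)"
    using valley[OF x assms(2,3)] assms(5) by linarith
  moreover have "d x (p k) + L (nat (k - j)) - D \<le> d x (p j)"
    using valley[OF x assms(3,4)] assms(6) by linarith
  ultimately show ?thesis by linarith
qed

text \<open>A point whose distance drops across the whole window \<open>[- n, n]\<close> at almost full speed does so on each
half. Such points should be thought of as lying in a neighbourhood of the endpoint of the axis at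
\<open>+\<infinity>\<close>, which shrinks as \<open>n\<close> grows.\<close>

lemma towards_forward_end:
  assumes x: "x \<in> M" and "L (2 * n) - D \<le> d x (p (- int n)) - d x (p (int n))"
  shows "d x (p (int n)) \<le> d x (p 0) - (L n - (D + L 1))"
    and "d x (p 0) + (L n - (D + L 1)) \<le> d x (p (- int n))"
proof -
  have "d x (p (- int n)) \<le> d x (p 0) + L n"
    using axis_triangle[OF x, of "- int n" 0] by simp
  moreover have "d x (p 0) \<le> d x (p (int n)) + L n"
    using axis_triangle[OF x, of 0 "int n"] by simp
  moreover have "2 * L n \<le> L (2 * n) + L 1"
    using L_superadd[of n n] unfolding mult_2 .
  ultimately show "d x (p (int n)) \<le> d x (p 0) - (L n - (D + L 1))"
    and "d x (p 0) + (L n - (D + L 1)) \<le> d x (p (- int n))"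
    using assms(2) by linarith+
qed

text \<open>In the next two lemmas, the Gromov product at \<open>p 0\<close> of two points near one end of the axis is large,
and that of two points near different ends is bounded.\<close>

lemma same_end_close:
  assumes x: "x \<in> M" "L (2 * n) - D \<le> d x (p (- int n)) - d x (p (int n))"
    and y: "y \<in> M" "L (2 * n) - D \<le> d y (p (- int n)) - d y (p (int n))"
  shows "d x y \<le> d x (p 0) + d y (p 0) - 2 * L n + (D + L 1) + 2 * \<delta>"
proof -
  have "d x y + d (p 0) (p (int n)) \<le>
      max (d x (p 0) + d y (p (int n))) (d x (p (int n)) + d (p 0) y) + 2 * \<delta>"
    by (intro four_point x(1) y(1) axis_in)
  moreover have "d (p 0) y = d y (p 0)" by (rule commute)
  moreover have "d (p 0) (p (int n)) = L n" by (simp add: axis_dist)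
  ultimately show ?thesis
    using towards_forward_end(1)[OF x] towards_forward_end(1)[OF y] by simp
qed

lemma opposite_ends_apart:
  assumes x: "x \<in> M" "L (2 * n) - D \<le> d x (p (- int n)) - d x (p (int n))"
    and y: "y \<in> M" "L (2 * n) - D \<le> d y (p (int n)) - d y (p (- int n))"
    and n: "D + L 1 + \<delta> < L n"
  shows "d x (p 0) + d y (p 0) - (D + L 1) - 2 * \<delta> \<le> d x y"
proof -
  have "d x (p 0) + d (p (int n)) y \<le>
      max (d x (p (int n)) + d (p 0) y) (d x y + d (p (int n)) (p 0)) + 2 * \<delta>"
    using four_point[OF y(1) x(1) axis_in[of "int n"] axis_in[of 0]] by (simp add: commute)
  moreover have "d (p (int n)) y = d y (p (int n))" "d (p 0) y = d y (p 0)" by (rule commute)+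
  moreover have "d (p (int n)) (p 0) = L n" by (simp add: axis_dist)
  moreover have "d y (p 0) + (L n - (D + L 1)) \<le> d y (p (int n))"
    using hyperbolic_axis.towards_forward_end(2)[OF reflect y(1), of n] y(2)
    by (simp add: hyperbolic_axis.D_def[OF reflect] D_def)
  ultimately show ?thesis
    using towards_forward_end(1)[OF x] n by simp
qed

text \<open>Once the window is long enough, enlarging it does not change the end of the axis that a point is
close to.\<close>

lemma forward_sign:
  assumes x: "x \<in> M" and v: "L (2 * n) - D \<le> d x (p (- int n)) - d x (p (int n))"
    and m: "m \<le> n" "D + 2 * L 1 < L (2 * m)"
  shows "d x (p (int m)) < d x (p (- int m))"
proof -
  have "nat \<bar>- int n - - int m\<bar> = n - m" "nat \<bar>int m - int n\<bar> = n - m"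
    using m by linarith+
  note dist = this
  have "d x (p (- int n)) \<le> d x (p (- int m)) + L (n - m)"
    using axis_triangle[OF x, of "- int n" "- int m"] unfolding dist .
  moreover have "d x (p (int m)) \<le> d x (p (int n)) + L (n - m)"
    using axis_triangle[OF x, of "int m" "int n"] unfolding dist .
  moreover have "2 * L (n - m) \<le> L (2 * (n - m)) + L 1"
    using L_superadd[of "n - m" "n - m"] unfolding mult_2 .
  moreover have "L (2 * m) + L (2 * (n - m)) \<le> L (2 * n) + L 1"
    using L_superadd[of "2 * m" "2 * (n - m)"] m
    by (simp flip: add_mult_distrib2)
  ultimately show ?thesis using v m by linarith
qed

end

section \<open>Invariant means\<close>

locale mean_group = group G for G (structure) +
  fixes \<mu> :: "('a \<Rightarrow> real) \<Rightarrow> real"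
  assumes mean: "left_invariant_mean G \<mu>"
begin

lemma bounded_functionI:
  assumes "\<And>k. k \<in> carrier G \<Longrightarrow> \<bar>f k\<bar> \<le> B"
  shows "f \<in> bounded_functions G"
  using assms unfolding bounded_functions_def bounded_iff by auto

lemma bounded_functionE:
  assumes "f \<in> bounded_functions G"
  obtains B where "\<And>k. k \<in> carrier G \<Longrightarrow> \<bar>f k\<bar> \<le> B"
  using assms unfolding bounded_functions_def bounded_iff by auto

lemma bounded_function_add:
  assumes "f \<in> bounded_functions G" "g \<in> bounded_functions G"
  shows "(\<lambda>k. f k + g k) \<in> bounded_functions G"
proof -
  obtain A where "\<And>k. k \<in> carrier G \<Longrightarrow> \<bar>f k\<bar> \<le> A"
    using bounded_functionE[OF assms(1)] by blast
  moreover obtain B where "\<And>k. k \<in> carrier G \<Longrightarrow> \<bar>g k\<bar> \<le> B"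
    using bounded_functionE[OF assms(2)] by blast
  ultimately show ?thesis
    by (intro bounded_functionI[of _ "A + B"]) (smt (verit))
qed

lemma bounded_function_mult:
  assumes "f \<in> bounded_functions G" "g \<in> bounded_functions G"
  shows "(\<lambda>k. f k * g k) \<in> bounded_functions G"
proof -
  obtain A where "\<And>k. k \<in> carrier G \<Longrightarrow> \<bar>f k\<bar> \<le> A"
    using bounded_functionE[OF assms(1)] by blast
  moreover obtain B where "\<And>k. k \<in> carrier G \<Longrightarrow> \<bar>g k\<bar> \<le> B"
    using bounded_functionE[OF assms(2)] by blast
  ultimately have "\<bar>f k * g k\<bar> \<le> A * B" if "k \<in> carrier G" for k
    using that unfolding abs_mult by (intro mult_mono) (auto intro: order_trans[OF abs_ge_zero])
  then show ?thesis by (rule bounded_functionI)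
qed

lemma bounded_function_const: "(\<lambda>_. c) \<in> bounded_functions G"
  by (rule bounded_functionI[of _ "\<bar>c\<bar>"]) simp

lemma bounded_function_translate:
  assumes "f \<in> bounded_functions G" "h \<in> carrier G"
  shows "(\<lambda>k. f (h \<otimes> k)) \<in> bounded_functions G"
proof -
  obtain B where "\<And>k. k \<in> carrier G \<Longrightarrow> \<bar>f k\<bar> \<le> B"
    using bounded_functionE[OF assms(1)] by blast
  then show ?thesis using assms(2) by (intro bounded_functionI[of _ B]) simp
qed

lemma bounded_function_sum:
  assumes "finite I" "\<And>i. i \<in> I \<Longrightarrow> f i \<in> bounded_functions G"
  shows "(\<lambda>k. \<Sum>i\<in>I. f i k) \<in> bounded_functions G"
  using assms
  by (induction I) (auto intro: bounded_function_add bounded_function_const)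

lemmas bounded_function_intros =
  bounded_function_add bounded_function_mult bounded_function_const bounded_function_translate
  bounded_function_sum

lemma mean_add:
  "f \<in> bounded_functions G \<Longrightarrow> g \<in> bounded_functions G \<Longrightarrow> \<mu> (\<lambda>k. f k + g k) = \<mu> f + \<mu> g"
  using mean unfolding left_invariant_mean_def by blast

lemma mean_cmult: "f \<in> bounded_functions G \<Longrightarrow> \<mu> (\<lambda>k. c * f k) = c * \<mu> f"
  using mean unfolding left_invariant_mean_def by blast

lemma mean_nonneg: "f \<in> bounded_functions G \<Longrightarrow> (\<And>k. k \<in> carrier G \<Longrightarrow> 0 \<le> f k) \<Longrightarrow> 0 \<le> \<mu> f"
  using mean unfolding left_invariant_mean_def by blast

lemma mean_translate:
  "f \<in> bounded_functions G \<Longrightarrow> h \<in> carrier G \<Longrightarrow> \<mu> (\<lambda>k. f (h \<otimes> k)) = \<mu> f"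
  using mean unfolding left_invariant_mean_def by blast

lemma mean_one: "\<mu> (\<lambda>_. 1) = 1"
  using mean unfolding left_invariant_mean_def by blast

lemma mean_const: "\<mu> (\<lambda>_. c) = c"
  using mean_cmult[OF bounded_function_const, of c 1] by (simp add: mean_one)

lemma mean_mono:
  assumes f: "f \<in> bounded_functions G" and g: "g \<in> bounded_functions G"
    and le: "\<And>k. k \<in> carrier G \<Longrightarrow> f k \<le> g k"
  shows "\<mu> f \<le> \<mu> g"
proof -
  have f': "(\<lambda>k. - 1 * f k) \<in> bounded_functions G"
    by (intro bounded_function_intros f)
  have "0 \<le> \<mu> (\<lambda>k. g k + - 1 * f k)"
    using le by (intro mean_nonneg bounded_function_add g f') simp
  also have "\<dots> = \<mu> g - \<mu> f"
    using mean_add[OF g f'] mean_cmult[OF f, of "- 1"] by simp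
  finally show ?thesis by simp
qed

lemma mean_sum:
  assumes "finite I" "\<And>i. i \<in> I \<Longrightarrow> f i \<in> bounded_functions G"
  shows "\<mu> (\<lambda>k. \<Sum>i\<in>I. f i k) = (\<Sum>i\<in>I. \<mu> (f i))"
  using assms
proof (induction I)
  case empty
  show ?case using mean_const[of 0] by simp
next
  case (insert i I)
  then show ?case
    using mean_add[of "f i" "\<lambda>k. \<Sum>i\<in>I. f i k"] bounded_function_sum[of I f] by simp
qed

text \<open>A finitely additive substitute for "almost everywhere": the exceptional set has measure \<open>0\<close> for the
finitely additive probability measure defined by the mean.\<close>

definition almost_all :: "('a \<Rightarrow> bool) \<Rightarrow> bool" where
  "almost_all P \<longleftrightarrow> \<mu> (\<lambda>k. of_bool (\<not> P k)) = 0"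

lemma bounded_function_of_bool: "(\<lambda>k. of_bool (P k)) \<in> bounded_functions G"
  by (rule bounded_functionI[of _ 1]) simp

lemma almost_allI:
  assumes "\<mu> (\<lambda>k. of_bool (\<not> P k)) \<le> 0"
  shows "almost_all P"
  unfolding almost_all_def
  using assms mean_nonneg[OF bounded_function_of_bool, of "\<lambda>k. \<not> P k"] by simp

lemma almost_all_mono:
  assumes "almost_all P" "\<And>k. k \<in> carrier G \<Longrightarrow> P k \<Longrightarrow> Q k"
  shows "almost_all Q"
proof (rule almost_allI)
  have "\<mu> (\<lambda>k. of_bool (\<not> Q k)) \<le> \<mu> (\<lambda>k. of_bool (\<not> P k))"
    using assms(2) by (intro mean_mono bounded_function_of_bool) auto
  then show "\<mu> (\<lambda>k. of_bool (\<not> Q k)) \<le> 0"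
    using assms(1) by (simp add: almost_all_def)
qed

lemma almost_all_conj:
  assumes "almost_all P" "almost_all Q"
  shows "almost_all (\<lambda>k. P k \<and> Q k)"
proof (rule almost_allI)
  have "\<mu> (\<lambda>k. of_bool (\<not> (P k \<and> Q k))) \<le> \<mu> (\<lambda>k. of_bool (\<not> P k) + of_bool (\<not> Q k))"
    by (intro mean_mono bounded_function_of_bool bounded_function_add) auto
  also have "\<dots> = 0"
    using assms mean_add[OF bounded_function_of_bool bounded_function_of_bool, of "\<lambda>k. \<not> P k" "\<lambda>k. \<not> Q k"]
    by (simp add: almost_all_def)
  finally show "\<mu> (\<lambda>k. of_bool (\<not> (P k \<and> Q k))) \<le> 0" .
qed

lemma almost_all_translate:
  assumes "almost_all P" "h \<in> carrier G"
  shows "almost_all (\<lambda>k. P (h \<otimes> k))"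
  using mean_translate[OF bounded_function_of_bool assms(2), of "\<lambda>k. \<not> P k"] assms(1)
  by (simp add: almost_all_def)

lemma almost_all_ex:
  assumes "almost_all P"
  obtains k where "k \<in> carrier G" "P k"
proof -
  have False if "\<And>k. k \<in> carrier G \<Longrightarrow> \<not> P k"
  proof -
    have "\<mu> (\<lambda>_. 1) \<le> \<mu> (\<lambda>k. of_bool (\<not> P k))"
      using that by (intro mean_mono bounded_function_of_bool bounded_function_const) auto
    then show False using assms by (simp add: mean_one almost_all_def)
  qed
  then show thesis using that by blast
qed

lemma mean_mono_almost_all:
  assumes f: "f \<in> bounded_functions G" and g: "g \<in> bounded_functions G"
    and le: "almost_all (\<lambda>k. f k \<le> g k)"
  shows "\<mu> f \<le> \<mu> g"
proof -
  obtain A where A: "\<And>k. k \<in> carrier G \<Longrightarrow> \<bar>f k\<bar> \<le> A" using bounded_functionE[OF f] by blast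
  obtain B where B: "\<And>k. k \<in> carrier G \<Longrightarrow> \<bar>g k\<bar> \<le> B" using bounded_functionE[OF g] by blast
  let ?e = "\<lambda>k. (A + B) * of_bool (\<not> f k \<le> g k)"
  have e: "?e \<in> bounded_functions G"
    by (intro bounded_function_mult bounded_function_const bounded_function_of_bool)
  have "f k \<le> g k + ?e k" if "k \<in> carrier G" for k
    using A[OF that] B[OF that] by (cases "f k \<le> g k") auto
  then have "\<mu> f \<le> \<mu> (\<lambda>k. g k + ?e k)"
    by (intro mean_mono f bounded_function_add g e)
  also have "\<dots> = \<mu> g + (A + B) * \<mu> (\<lambda>k. of_bool (\<not> f k \<le> g k))"
    by (subst mean_add[OF g e]) (subst mean_cmult[OF bounded_function_of_bool], rule refl)
  also have "\<dots> = \<mu> g" using le by (simp add: almost_all_def)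
  finally show ?thesis .
qed

lemma mean_cong_almost_all:
  assumes f: "f \<in> bounded_functions G" and g: "g \<in> bounded_functions G"
    and eq: "almost_all (\<lambda>k. f k = g k)"
  shows "\<mu> f = \<mu> g"
  by (intro antisym mean_mono_almost_all f g; rule almost_all_mono[OF eq]; simp)

text \<open>The translates of the exceptional set by the elements \<open>t i\<close> are pairwise disjoint and have the same
measure, and the total measure is \<open>1\<close>, so this measure is \<open>0\<close>.\<close>

lemma almost_all_if_wandering:
  fixes t :: "nat \<Rightarrow> 'a"
  assumes t: "\<And>i. t i \<in> carrier G"
    and wander: "\<And>i j k. \<lbrakk>i < j; k \<in> carrier G; \<not> P (t i \<otimes> k)\<rbrakk> \<Longrightarrow> P (t j \<otimes> k)"
  shows "almost_all P"
proof (rule almost_allI)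
  let ?e = "\<lambda>k. of_bool (\<not> P k) :: real"
  have le1: "real r * \<mu> ?e \<le> 1" for r
  proof -
    have "(\<Sum>i<r. ?e (t i \<otimes> k)) \<le> 1" if k: "k \<in> carrier G" for k
    proof -
      have "card {i \<in> {..<r}. \<not> P (t i \<otimes> k)} \<le> Suc 0"
        using wander[OF _ k] by (subst card_le_Suc0_iff_eq) (auto, metis linorder_neqE_nat)
      then show ?thesis
        by (simp add: of_bool_def sum.If_cases Int_def del: card_le_Suc0_iff_eq)
    qed
    then have "\<mu> (\<lambda>k. \<Sum>i<r. ?e (t i \<otimes> k)) \<le> \<mu> (\<lambda>_. 1)"
      using t by (intro mean_mono bounded_function_intros bounded_function_of_bool) auto
    moreover have "\<mu> (\<lambda>k. \<Sum>i<r. ?e (t i \<otimes> k)) = (\<Sum>i<r. \<mu> (\<lambda>k. ?e (t i \<otimes> k)))"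
      by (intro mean_sum bounded_function_of_bool) auto
    moreover have "\<mu> (\<lambda>k. ?e (t i \<otimes> k)) = \<mu> ?e" for i
      by (intro mean_translate[of ?e] bounded_function_of_bool t)
    ultimately show ?thesis by (simp add: mean_one)
  qed
  show "\<mu> ?e \<le> 0"
  proof (rule ccontr)
    assume "\<not> \<mu> ?e \<le> 0"
    then have "\<mu> ?e > 0" by simp
    then obtain r :: nat where "1 < real r * \<mu> ?e" using reals_Archimedean3 by blast
    then show False using le1[of r] by simp
  qed
qed

end

section \<open>The orbit of an amenable group seen from an axis\<close>

text \<open>The mean on the group is viewed as an invariant finitely additive probability measure on the orbit of
\<open>base\<close>, and the axis is the orbit of \<open>base\<close> under the powers of \<open>a\<close>.\<close>

locale amenable_axis = mean_group G \<mu> + hyperbolic_axis M d \<delta> p L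
  for G (structure) and \<mu> and M :: "'x set" and d \<delta> p L +
  fixes \<phi> :: "'a \<Rightarrow> 'x \<Rightarrow> 'x" and base :: 'x and a :: 'a
  assumes action: "isometric_action G M d \<phi>"
    and base_in: "base \<in> M"
    and a_in: "a \<in> carrier G"
    and axis_eq: "p i = \<phi> (a [^] i) base"
begin

lemma act_in: "h \<in> carrier G \<Longrightarrow> y \<in> M \<Longrightarrow> \<phi> h y \<in> M"
  using action group_action.element_image unfolding isometric_action_def by fastforce

lemma act_mult: "g \<in> carrier G \<Longrightarrow> h \<in> carrier G \<Longrightarrow> y \<in> M \<Longrightarrow> \<phi> (g \<otimes> h) y = \<phi> g (\<phi> h y)"
  using action group_action.composition_rule unfolding isometric_action_def by fastforce

lemma act_dist: "h \<in> carrier G \<Longrightarrow> x \<in> M \<Longrightarrow> y \<in> M \<Longrightarrow> d (\<phi> h x) (\<phi> h y) = d x y"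
  using action unfolding isometric_action_def by blast

lemma act_one: "y \<in> M \<Longrightarrow> \<phi> \<one> y = y"
  using action group_action.id_eq_one unfolding isometric_action_def by (metis restrict_apply)

lemma base_eq: "base = p 0"
  by (simp add: axis_eq act_one base_in)

lemma translate_axis: "\<phi> (a [^] (s::int)) (p i) = p (s + i)"
  by (simp add: axis_eq int_pow_mult a_in act_mult base_in)

definition orbit_dist :: "'a \<Rightarrow> 'x \<Rightarrow> real" where
  "orbit_dist k y = d (\<phi> k base) y"

lemma orbit_dist_translate:
  "\<lbrakk>h \<in> carrier G; k \<in> carrier G; y \<in> M\<rbrakk> \<Longrightarrow> orbit_dist (h \<otimes> k) (\<phi> h y) = orbit_dist k y"
  by (simp add: orbit_dist_def act_mult base_in act_dist act_in)

lemma orbit_dist_axis_translate: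
  assumes "k \<in> carrier G"
  shows "orbit_dist (a [^] (s::int) \<otimes> k) (p i) = orbit_dist k (p (i - s))"
  using orbit_dist_translate[of "a [^] s" k "p (i - s)"] assms
  by (simp add: translate_axis a_in axis_in)

text \<open>How much closer to the orbit point the axis gets between the times \<open>- n\<close> and \<open>n\<close>. It is positive
when the orbit point is on the side of the forward end.\<close>

definition drift :: "'a \<Rightarrow> nat \<Rightarrow> real" where
  "drift k n = orbit_dist k (p (- int n)) - orbit_dist k (p (int n))"

lemma L_unbounded: "\<exists>n\<ge>m. B < L n"
proof -
  obtain n where "B < real n" using reals_Archimedean2 by blast
  then have "B < L (max m n)" using L_ge[of "max m n"] by simp
  then show ?thesis by (intro exI[of _ "max m n"]) simp
qed

text \<open>The elements for which a window is flat form a wandering set: translating by a power of \<open>a\<close> shifts the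
window along the axis, and no point has two flat windows that are far apart.\<close>

lemma almost_all_drift: "almost_all (\<lambda>k. L (2 * n) - D \<le> \<bar>drift k n\<bar>)"
proof -
  obtain q where q: "D < L q" using L_unbounded by blast
  define t where "t i = a [^] (int (2 * n + q) * int i)" for i
  show ?thesis
  proof (rule almost_all_if_wandering[where t = t])
    show "t i \<in> carrier G" for i by (simp add: t_def a_in)
  next
    fix i j :: nat and k
    assume ij: "i < j" and k: "k \<in> carrier G" and i: "\<not> L (2 * n) - D \<le> \<bar>drift (t i \<otimes> k) n\<bar>"
    define w where "w = int (2 * n + q)"
    show "L (2 * n) - D \<le> \<bar>drift (t j \<otimes> k) n\<bar>"
    proof (rule ccontr)
      assume j: "\<not> L (2 * n) - D \<le> \<bar>drift (t j \<otimes> k) n\<bar>"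
      have x: "\<phi> k base \<in> M" by (simp add: act_in k base_in)
      have drift: "\<bar>drift (t i \<otimes> k) n\<bar> =
          \<bar>d (\<phi> k base) (p (- int n - w * int i)) - d (\<phi> k base) (p (int n - w * int i))\<bar>" for i
        unfolding drift_def t_def w_def[symmetric] orbit_dist_axis_translate[OF k]
        by (simp add: orbit_dist_def)
      have width: "nat ((int n - s) - (- int n - s)) = 2 * n" for s by simp
      have sep: "int n - w * int j + int q \<le> - int n - w * int i"
      proof -
        have "w * int (Suc i) \<le> w * int j"
          using ij by (intro mult_left_mono) (auto simp: w_def)
        then show ?thesis by (simp add: w_def algebra_simps)
      qed
      have "L (nat ((- int n - w * int i) - (int n - w * int j))) \<le> D"
        using i j sep unfolding drift
        by (intro flat_windows_close[OF x, where i = "- int n - w * int j" and l = "int n - w * int i"])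
          (auto simp only: width not_le)
      moreover have "L q \<le> L (nat ((- int n - w * int i) - (int n - w * int j)))"
        using sep by (intro L_mono) simp
      ultimately show False using q by simp
    qed
  qed
qed

text \<open>A window length from which on the sign of the drift no longer changes at points with almost full
drift, by \<open>forward_sign\<close>.\<close>

definition threshold :: nat where
  "threshold = (SOME m. D + 2 * L 1 < L (2 * m))"

lemma threshold: "D + 2 * L 1 < L (2 * threshold)"
  unfolding threshold_def
proof (rule someI_ex)
  obtain n where "D + 2 * L 1 < L n" using L_unbounded by blast
  then show "\<exists>m. D + 2 * L 1 < L (2 * m)"
    using L_mono[of n "2 * n"] by (intro exI[of _ n]) simp
qed

text \<open>The end of the axis, \<open>1\<close> for forward and \<open>- 1\<close> for backward, that almost every orbit point is near.\<close>

definition end_sign :: "'a \<Rightarrow> real" where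
  "end_sign k = (if drift k threshold > 0 then 1 else - 1)"

lemma end_sign_cases: "end_sign k = 1 \<or> end_sign k = - 1"
  by (simp add: end_sign_def)

lemma bounded_end_sign: "end_sign \<in> bounded_functions G"
  by (rule bounded_functionI[of _ 1]) (simp add: end_sign_def)

definition deep :: "nat \<Rightarrow> 'a \<Rightarrow> bool" where
  "deep n k \<longleftrightarrow> L (2 * n) - D \<le> end_sign k * drift k n"

text \<open>Seen from the mean, the orbit is concentrated at the two ends of the axis, and for all \<open>n\<close> the same
partition by \<open>end_sign\<close> tells which end.\<close>

lemma almost_all_deep:
  assumes n: "threshold \<le> n"
  shows "almost_all (deep n)"
proof (rule almost_all_mono[OF almost_all_drift[of n]])
  fix k assume k: "k \<in> carrier G" and v: "L (2 * n) - D \<le> \<bar>drift k n\<bar>"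
  have x: "\<phi> k base \<in> M" by (simp add: act_in k base_in)
  show "deep n k"
  proof (cases "drift k n \<ge> 0")
    case True
    then have "drift k threshold > 0"
      using forward_sign[OF x _ n threshold] v by (simp add: drift_def orbit_dist_def)
    then show ?thesis using True v by (simp add: deep_def end_sign_def)
  next
    case False
    then have "drift k threshold < 0"
      using hyperbolic_axis.forward_sign[OF reflect x, of n threshold] n threshold v
      by (simp add: drift_def orbit_dist_def hyperbolic_axis.D_def[OF reflect] D_def)
    then show ?thesis using False v by (simp add: deep_def end_sign_def)
  qed
qed

lemma deep_same_sign:
  assumes "k \<in> carrier G" "deep n k" "k' \<in> carrier G" "deep n k'" "end_sign k = end_sign k'"
  shows "d (\<phi> k base) (\<phi> k' base) \<le>
    orbit_dist k base + orbit_dist k' base - 2 * L n + (D + L 1) + 2 * \<delta>"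
proof -
  have x: "\<phi> k base \<in> M" and y: "\<phi> k' base \<in> M" using assms by (simp_all add: act_in base_in)
  from end_sign_cases[of k] show ?thesis
  proof
    assume "end_sign k = 1"
    then show ?thesis
      using same_end_close[OF x _ y, of n] assms
      by (simp add: deep_def drift_def orbit_dist_def base_eq[symmetric])
  next
    assume "end_sign k = - 1"
    then show ?thesis
      using hyperbolic_axis.same_end_close[OF reflect x _ y, of n] assms
      by (simp add: deep_def drift_def orbit_dist_def base_eq[symmetric] hyperbolic_axis.D_def[OF reflect] D_def)
  qed
qed

lemma deep_opposite_sign:
  assumes "k \<in> carrier G" "deep n k" "k' \<in> carrier G" "deep n k'" "end_sign k \<noteq> end_sign k'"
    and n: "D + L 1 + \<delta> < L n"
  shows "orbit_dist k base + orbit_dist k' base - (D + L 1) - 2 * \<delta> \<le> d (\<phi> k base) (\<phi> k' base)"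
proof -
  have x: "\<phi> k base \<in> M" and y: "\<phi> k' base \<in> M" using assms by (simp_all add: act_in base_in)
  from end_sign_cases[of k] show ?thesis
  proof
    assume s: "end_sign k = 1"
    then have "end_sign k' = - 1" using end_sign_cases[of k'] assms(5) by simp
    then show ?thesis
      using opposite_ends_apart[OF x _ y, of n] assms s
      by (simp add: deep_def drift_def orbit_dist_def base_eq[symmetric])
  next
    assume s: "end_sign k = - 1"
    then have "end_sign k' = 1" using end_sign_cases[of k'] assms(5) by simp
    then show ?thesis
      using opposite_ends_apart[OF y _ x, of n] assms s
      by (simp add: deep_def drift_def orbit_dist_def base_eq[symmetric] commute[of "\<phi> k base"])
  qed
qed

text \<open>The translate of the axis by an element of the group has the same two ends, because the mean is
concentrated at the ends of both axes. In detail: two generic elements with the same sign have a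
large Gromov product; translation by \<open>h\<close> changes it by a bounded amount, hence their translates have
the same sign as well. So almost everywhere the sign of \<open>h \<otimes> k\<close> is a function of the sign of \<open>k\<close>. It is
not a constant function, since the mean of the sign is \<open>0\<close> and invariant; so it is plus or
minus the identity.\<close>

lemma end_sign_equivariant:
  assumes h: "h \<in> carrier G" and balanced: "\<mu> end_sign = 0"
  shows "\<exists>e::int. (e = 1 \<or> e = - 1) \<and> almost_all (\<lambda>k. end_sign (h \<otimes> k) = of_int e * end_sign k)"
proof (rule ccontr)
  define s where "s = d base (\<phi> h base)"
  obtain n where n: "threshold \<le> n" "D + L 1 + 2 * \<delta> + s < L n"
    using L_unbounded by blast
  assume no: "\<nexists>e::int. (e = 1 \<or> e = - 1) \<and>
      almost_all (\<lambda>k. end_sign (h \<otimes> k) = of_int e * end_sign k)"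
  define good where "good k \<longleftrightarrow> deep n k \<and> deep n (h \<otimes> k)" for k
  have good: "almost_all good"
    unfolding good_def by (intro almost_all_conj almost_all_translate almost_all_deep n h)
  have "s \<ge> 0" by (simp add: s_def)
  then have n': "D + L 1 + \<delta> < L n" using n delta_nonneg by simp
  have same: "end_sign (h \<otimes> k) = end_sign (h \<otimes> k')"
    if k: "k \<in> carrier G" "good k" and k': "k' \<in> carrier G" "good k'"
      and eq: "end_sign k = end_sign k'" for k k'
  proof (rule ccontr)
    assume neq: "end_sign (h \<otimes> k) \<noteq> end_sign (h \<otimes> k')"
    have far: "orbit_dist k base - s \<le> orbit_dist (h \<otimes> k) base" if "k \<in> carrier G" for k
    proof -
      have "orbit_dist k base = orbit_dist (h \<otimes> k) (\<phi> h base)"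
        using orbit_dist_translate[OF h that base_in] by simp
      also have "\<dots> \<le> orbit_dist (h \<otimes> k) base + s"
        unfolding orbit_dist_def s_def by (intro triangle act_in base_in m_closed h that)
      finally show ?thesis by simp
    qed
    have "orbit_dist (h \<otimes> k) base + orbit_dist (h \<otimes> k') base - (D + L 1) - 2 * \<delta>
        \<le> d (\<phi> (h \<otimes> k) base) (\<phi> (h \<otimes> k') base)"
      using k k' h neq n' by (intro deep_opposite_sign) (auto simp: good_def)
    also have "\<dots> = d (\<phi> k base) (\<phi> k' base)"
      using h k k' by (simp add: act_mult act_dist act_in base_in)
    also have "\<dots> \<le> orbit_dist k base + orbit_dist k' base - 2 * L n + (D + L 1) + 2 * \<delta>"
      using k k' eq by (intro deep_same_sign) (auto simp: good_def)
    finally show False using far[OF k(1)] far[OF k'(1)] n(2) by linarith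
  qed
  have ex: "\<exists>k\<in>carrier G. good k \<and> end_sign (h \<otimes> k) \<noteq> of_int e * end_sign k"
    if "e = 1 \<or> e = - 1" for e :: int
  proof (rule ccontr)
    assume "\<not> (\<exists>k\<in>carrier G. good k \<and> end_sign (h \<otimes> k) \<noteq> of_int e * end_sign k)"
    then have "almost_all (\<lambda>k. end_sign (h \<otimes> k) = of_int e * end_sign k)"
      by (intro almost_all_mono[OF good]) blast
    then show False using no that by blast
  qed
  obtain k where k: "k \<in> carrier G" "good k" "end_sign (h \<otimes> k) \<noteq> end_sign k"
    using ex[of 1] by auto
  obtain k' where k': "k' \<in> carrier G" "good k'" "end_sign (h \<otimes> k') \<noteq> - end_sign k'"
    using ex[of "- 1"] by auto
  have "end_sign (h \<otimes> l) = end_sign (h \<otimes> k)" if l: "l \<in> carrier G" "good l" for l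
    using same[OF l k(1,2)] same[OF l k'(1,2)] same[OF k(1,2) k'(1,2)] k(3) k'(3)
      end_sign_cases[of k] end_sign_cases[of k'] end_sign_cases[of l]
      end_sign_cases[of "h \<otimes> k"] end_sign_cases[of "h \<otimes> k'"]
    by force
  then have "almost_all (\<lambda>l. end_sign (h \<otimes> l) = end_sign (h \<otimes> k))"
    by (rule almost_all_mono[OF good])
  then have "\<mu> (\<lambda>l. end_sign (h \<otimes> l)) = \<mu> (\<lambda>_. end_sign (h \<otimes> k))"
    by (intro mean_cong_almost_all bounded_function_intros bounded_end_sign h)
  then have "end_sign (h \<otimes> k) = 0"
    using mean_translate[OF bounded_end_sign h] balanced by (simp add: mean_const)
  then show False using end_sign_cases[of "h \<otimes> k"] by auto
qed

text \<open>The horofunction cocycle \<open>d x o - d x (h o)\<close> at the orbit point \<open>x\<close> of \<open>k\<close>. If \<open>x\<close> goes to a point at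
infinity, this becomes a Busemann cocycle.\<close>

definition displacement :: "'a \<Rightarrow> 'a \<Rightarrow> real" where
  "displacement h k = orbit_dist k base - orbit_dist k (\<phi> h base)"

lemma bounded_displacement:
  assumes h: "h \<in> carrier G"
  shows "displacement h \<in> bounded_functions G"
proof (rule bounded_functionI)
  fix k assume "k \<in> carrier G"
  then show "\<bar>displacement h k\<bar> \<le> d base (\<phi> h base)"
    using mdist_reverse_triangle[OF base_in, of "\<phi> k base" "\<phi> h base"] h
    by (simp add: displacement_def orbit_dist_def act_in base_in commute[of base])
qed

lemma displacement_mult:
  assumes "g \<in> carrier G" "h \<in> carrier G" "k \<in> carrier G"
  shows "displacement (g \<otimes> h) k = displacement g k + displacement h (inv g \<otimes> k)"
proof -
  have "g \<otimes> (inv g \<otimes> k) = k" using assms by (simp add: m_assoc[symmetric])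
  then have "orbit_dist k (\<phi> g y) = orbit_dist (inv g \<otimes> k) y" if "y \<in> M" for y
    using orbit_dist_translate[of g "inv g \<otimes> k" y] assms that by simp
  then show ?thesis
    using assms by (simp add: displacement_def act_mult act_in base_in)
qed

text \<open>Averaging the horofunction cocycle against a density \<open>\<sigma>\<close> that is invariant up to sign: the second
summand of \<open>displacement_mult\<close> is a translate, invariance of the mean removes the translation, and
\<open>\<sigma>\<close> contributes the sign \<open>\<epsilon> g\<close>. No error term appears, so there is no quasimorphism to
homogenize.\<close>

lemma signed_cocycle_mean_displacement:
  fixes \<sigma> :: "'a \<Rightarrow> real"
  assumes \<sigma>: "\<And>k. \<sigma> k = 1 \<or> \<sigma> k = - 1"
    and \<epsilon>: "\<And>h. h \<in> carrier G \<Longrightarrow> \<epsilon> h = (1::int) \<or> \<epsilon> h = - 1"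
    and eq: "\<And>h. h \<in> carrier G \<Longrightarrow> almost_all (\<lambda>k. \<sigma> (h \<otimes> k) = of_int (\<epsilon> h) * \<sigma> k)"
  shows "signed_cocycle G \<epsilon> (\<lambda>h. \<mu> (\<lambda>k. \<sigma> k * displacement h k))"
  unfolding signed_cocycle_def
proof (intro conjI ballI)
  fix g assume g: "g \<in> carrier G"
  show "\<epsilon> g = 1 \<or> \<epsilon> g = - 1" by (rule \<epsilon>[OF g])
  fix h assume h: "h \<in> carrier G"
  have "almost_all (\<lambda>k. (\<sigma> (g \<otimes> h \<otimes> k) = of_int (\<epsilon> (g \<otimes> h)) * \<sigma> k \<and>
      \<sigma> (h \<otimes> k) = of_int (\<epsilon> h) * \<sigma> k) \<and> \<sigma> (g \<otimes> (h \<otimes> k)) = of_int (\<epsilon> g) * \<sigma> (h \<otimes> k))"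
    using g h by (intro almost_all_conj almost_all_translate[OF eq] eq) auto
  then obtain k where "k \<in> carrier G" "\<sigma> (g \<otimes> h \<otimes> k) = of_int (\<epsilon> (g \<otimes> h)) * \<sigma> k"
      "\<sigma> (h \<otimes> k) = of_int (\<epsilon> h) * \<sigma> k" "\<sigma> (g \<otimes> (h \<otimes> k)) = of_int (\<epsilon> g) * \<sigma> (h \<otimes> k)"
    by (rule almost_all_ex) blast
  then have "real_of_int (\<epsilon> (g \<otimes> h)) = of_int (\<epsilon> g * \<epsilon> h)"
    using g h \<sigma>[of k] by (auto simp: m_assoc)
  then show "\<epsilon> (g \<otimes> h) = \<epsilon> g * \<epsilon> h" unfolding of_int_eq_iff .
  have b\<sigma>: "\<sigma> \<in> bounded_functions G"
    using \<sigma> by (intro bounded_functionI[of _ 1]) (metis abs_minus_cancel abs_one order_refl)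
  have bg: "(\<lambda>k. displacement h (inv g \<otimes> k)) \<in> bounded_functions G"
    by (intro bounded_function_intros bounded_displacement g h inv_closed)
  have "\<mu> (\<lambda>k. \<sigma> k * displacement (g \<otimes> h) k) =
      \<mu> (\<lambda>k. \<sigma> k * displacement g k + \<sigma> k * displacement h (inv g \<otimes> k))"
  proof (rule mean_cong_almost_all)
    show "almost_all (\<lambda>k. \<sigma> k * displacement (g \<otimes> h) k =
        \<sigma> k * displacement g k + \<sigma> k * displacement h (inv g \<otimes> k))"
      using g h by (intro almost_all_mono[OF eq[OF one_closed]])
        (simp add: displacement_mult distrib_left)
  qed (intro bounded_function_intros bounded_displacement b\<sigma> bg m_closed g h)+
  also have "\<dots> = \<mu> (\<lambda>k. \<sigma> k * displacement g k) + \<mu> (\<lambda>k. \<sigma> k * displacement h (inv g \<otimes> k))"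
    by (intro mean_add bounded_function_mult bounded_displacement b\<sigma> bg g)
  also have "\<mu> (\<lambda>k. \<sigma> k * displacement h (inv g \<otimes> k)) =
      \<mu> (\<lambda>k. \<sigma> (g \<otimes> k) * displacement h (inv g \<otimes> (g \<otimes> k)))"
    by (rule mean_translate[symmetric, OF bounded_function_mult[OF b\<sigma> bg] g])
  also have "\<dots> = \<mu> (\<lambda>k. of_int (\<epsilon> g) * (\<sigma> k * displacement h k))"
  proof (rule mean_cong_almost_all)
    show "almost_all (\<lambda>k. \<sigma> (g \<otimes> k) * displacement h (inv g \<otimes> (g \<otimes> k)) =
        of_int (\<epsilon> g) * (\<sigma> k * displacement h k))"
      using g by (intro almost_all_mono[OF eq[OF g]]) (simp add: m_assoc[symmetric])
    show "(\<lambda>k. \<sigma> (g \<otimes> k) * displacement h (inv g \<otimes> (g \<otimes> k))) \<in> bounded_functions G"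
      by (rule bounded_function_translate[OF bounded_function_mult[OF b\<sigma> bg] g])
  qed (intro bounded_function_intros bounded_displacement b\<sigma> h)
  also have "\<dots> = of_int (\<epsilon> g) * \<mu> (\<lambda>k. \<sigma> k * displacement h k)"
    by (intro mean_cmult bounded_function_intros bounded_displacement b\<sigma> h)
  finally show "\<mu> (\<lambda>k. \<sigma> k * displacement (g \<otimes> h) k) =
      \<mu> (\<lambda>k. \<sigma> k * displacement g k) + of_int (\<epsilon> g) * \<mu> (\<lambda>k. \<sigma> k * displacement h k)" .
qed

lemma displacement_deep:
  assumes k: "k \<in> carrier G" and "deep n k"
  shows "\<bar>displacement (a [^] int n) k - end_sign k * L n\<bar> \<le> D + L 1"
proof -
  have x: "\<phi> k base \<in> M" by (simp add: act_in k base_in)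
  have F: "displacement (a [^] int n) k = d (\<phi> k base) (p 0) - d (\<phi> k base) (p (int n))"
    by (simp add: displacement_def orbit_dist_def base_eq[symmetric] axis_eq[symmetric])
  have "d (\<phi> k base) (p 0) \<le> d (\<phi> k base) (p (int n)) + L n"
    "d (\<phi> k base) (p (int n)) \<le> d (\<phi> k base) (p 0) + L n"
    using axis_triangle[OF x, of 0 "int n"] axis_triangle[OF x, of "int n" 0] by simp_all
  moreover have "D + L 1 \<ge> 0" using D_nonneg L_mono[of 0 1] L_0 by simp
  moreover note end_sign_cases[of k]
  moreover have "d (\<phi> k base) (p (int n)) \<le> d (\<phi> k base) (p 0) - (L n - (D + L 1))"
    if "end_sign k = 1"
    using towards_forward_end(1)[OF x, of n] assms that
    by (simp add: deep_def drift_def orbit_dist_def)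
  moreover have "d (\<phi> k base) (p 0) + (L n - (D + L 1)) \<le> d (\<phi> k base) (p (int n))"
    if "end_sign k = - 1"
    using hyperbolic_axis.towards_forward_end(2)[OF reflect x, of n] assms that
    by (simp add: deep_def drift_def orbit_dist_def hyperbolic_axis.D_def[OF reflect] D_def)
  ultimately show ?thesis unfolding F by (elim disjE) (simp_all add: abs_le_iff)
qed

text \<open>By \<open>displacement_deep\<close>, \<open>a [^] n\<close> moves almost every orbit point by \<open>L n\<close>, up to a bounded
error, with the sign of the end that the orbit point is near. If the mean gives the two ends
different weights, the unweighted average is therefore a homomorphism that is nonzero at a large power
of \<open>a\<close>. If the weights are equal, this average may vanish, but then the group preserves the pair of
ends, and weighting by \<open>end_sign\<close> makes both ends contribute with the same sign.\<close>

lemma exists_signed_cocycle: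
  obtains \<epsilon> and c :: "'a \<Rightarrow> real" and b
    where "signed_cocycle G \<epsilon> c" "b \<in> carrier G" "\<epsilon> b = 1" "c b \<noteq> 0"
proof (cases "\<mu> end_sign = 0")
  case True
  have "\<forall>h\<in>carrier G. \<exists>e::int. (e = 1 \<or> e = - 1) \<and>
      almost_all (\<lambda>k. end_sign (h \<otimes> k) = of_int e * end_sign k)"
    using end_sign_equivariant[OF _ True] by blast
  from bchoice[OF this] obtain \<epsilon> :: "'a \<Rightarrow> int"
    where \<epsilon>: "\<forall>h\<in>carrier G. (\<epsilon> h = 1 \<or> \<epsilon> h = - 1) \<and>
      almost_all (\<lambda>k. end_sign (h \<otimes> k) = of_int (\<epsilon> h) * end_sign k)"
    by blast
  define c where "c h = \<mu> (\<lambda>k. end_sign k * displacement h k)" for h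
  have c: "signed_cocycle G \<epsilon> c"
    unfolding c_def using \<epsilon> end_sign_cases by (intro signed_cocycle_mean_displacement) auto
  obtain m where m: "threshold \<le> m" "D + L 1 < L m" using L_unbounded by blast
  \<comment> \<open>An even exponent, so that the sign of the power of \<open>a\<close> is \<open>1\<close> whatever that of \<open>a\<close> is.\<close>
  define n where "n = m + m"
  have n: "threshold \<le> n" "D + L 1 < L n" using m L_mono[of m n] by (auto simp: n_def)
  have sq: "a [^] int n = a [^] int m \<otimes> a [^] int m"
    unfolding n_def of_nat_add by (rule int_pow_mult[OF a_in])
  have "L n - (D + L 1) = \<mu> (\<lambda>_. L n - (D + L 1))" by (simp add: mean_const)
  also have "\<dots> \<le> c (a [^] int n)"
    unfolding c_def
  proof (rule mean_mono_almost_all)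
    show "almost_all (\<lambda>k. L n - (D + L 1) \<le> end_sign k * displacement (a [^] int n) k)"
    proof (rule almost_all_mono[OF almost_all_deep[OF n(1)]])
      fix k assume "k \<in> carrier G" "deep n k"
      then show "L n - (D + L 1) \<le> end_sign k * displacement (a [^] int n) k"
        using displacement_deep[of k n] end_sign_cases[of k] by auto
    qed
  qed (intro bounded_function_intros bounded_end_sign bounded_displacement int_pow_closed a_in)+
  finally have "c (a [^] int n) \<noteq> 0" using n(2) by simp
  moreover have "\<epsilon> (a [^] int n) = 1"
    unfolding sq using signed_cocycle_mult(1)[OF c, of "a [^] int m" "a [^] int m"]
      signed_cocycle_sign[OF c, of "a [^] int m"] a_in by auto
  ultimately show thesis using that[OF c, of "a [^] int n"] a_in by simp
next
  case False
  define c where "c h = \<mu> (\<lambda>k. 1 * displacement h k)" for h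
  have "almost_all (\<lambda>_. True)" by (simp add: almost_all_def mean_const)
  then have c: "signed_cocycle G (\<lambda>_. 1) c"
    unfolding c_def by (intro signed_cocycle_mean_displacement) auto
  obtain n0 where "D + L 1 < real n0 * \<bar>\<mu> end_sign\<bar>"
    using False reals_Archimedean3[of "\<bar>\<mu> end_sign\<bar>"] by auto
  moreover obtain n where n: "threshold \<le> n" "real n0 < L n" using L_unbounded by blast
  ultimately have big: "D + L 1 < L n * \<bar>\<mu> end_sign\<bar>"
    using mult_right_mono[of "real n0" "L n" "\<bar>\<mu> end_sign\<bar>"] by simp
  let ?F = "displacement (a [^] int n)"
  have bF: "?F \<in> bounded_functions G" by (intro bounded_displacement int_pow_closed a_in)
  have close: "almost_all (\<lambda>k. \<bar>?F k - end_sign k * L n\<bar> \<le> D + L 1)"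
    by (rule almost_all_mono[OF almost_all_deep[OF n(1)] displacement_deep])
  have L\<sigma>: "\<mu> (\<lambda>k. L n * end_sign k + e) = L n * \<mu> end_sign + e" for e
    using mean_add[OF bounded_function_mult[OF bounded_function_const bounded_end_sign] bounded_function_const]
    by (simp add: mean_cmult[OF bounded_end_sign] mean_const)
  have "\<mu> ?F \<le> \<mu> (\<lambda>k. L n * end_sign k + (D + L 1))"
  proof (rule mean_mono_almost_all)
    show "almost_all (\<lambda>k. ?F k \<le> L n * end_sign k + (D + L 1))"
      by (rule almost_all_mono[OF close]) (simp add: mult.commute abs_le_iff)
  qed (intro bounded_function_intros bounded_end_sign bF)+
  moreover have "\<mu> (\<lambda>k. L n * end_sign k + - (D + L 1)) \<le> \<mu> ?F"
  proof (rule mean_mono_almost_all)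
    show "almost_all (\<lambda>k. L n * end_sign k + - (D + L 1) \<le> ?F k)"
      by (rule almost_all_mono[OF close]) (simp add: mult.commute abs_le_iff)
  qed (intro bounded_function_intros bounded_end_sign bF)+
  ultimately have "\<bar>\<mu> ?F - L n * \<mu> end_sign\<bar> \<le> D + L 1"
    unfolding L\<sigma> by linarith
  moreover have "\<bar>L n * \<mu> end_sign\<bar> = L n * \<bar>\<mu> end_sign\<bar>"
    using n(2) by (simp add: abs_mult)
  ultimately have "c (a [^] int n) \<noteq> 0"
    using big by (auto simp: c_def)
  then show thesis using that[OF c, of "a [^] int n"] a_in by simp
qed

end

text \<open>If the gap failed at all powers of two, then \<open>len (2 ^ k)\<close> would grow at most linearly in \<open>k\<close>, against
the lower bound, which is exponential in \<open>k\<close>.\<close>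

lemma exists_scale_gap:
  fixes len :: "nat \<Rightarrow> real"
  assumes K: "K > 0" and lower: "\<And>n. real n / K - C \<le> len n"
  obtains N where "len N + S \<le> len (2 * N)"
proof -
  have "\<exists>k. len (2 ^ k) + S \<le> len (2 * 2 ^ k)"
  proof (rule ccontr)
    assume no: "\<nexists>k. len (2 ^ k) + S \<le> len (2 * 2 ^ k)"
    have up: "len (2 ^ k) \<le> len 1 + real k * S" for k
    proof (induction k)
      case (Suc k)
      have "len (2 ^ Suc k) < len (2 ^ k) + S" using no by (simp add: not_le)
      then show ?case using Suc by (simp add: algebra_simps)
    qed simp
    have "(\<lambda>k. (len 1 + C) * (1 / 2) ^ k + S * (real k * (1 / 2) ^ k)) \<longlonglongrightarrow> (len 1 + C) * 0 + S * 0"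
      by (intro tendsto_intros LIMSEQ_power_zero powser_times_n_limit_0) auto
    then have "\<forall>\<^sub>F k in sequentially. (len 1 + C) * (1 / 2) ^ k + S * (real k * (1 / 2) ^ k) < 1 / K"
      by (rule order_tendstoD) (use K in simp)
    then obtain k where k: "(len 1 + C) * (1 / 2) ^ k + S * (real k * (1 / 2) ^ k) < 1 / K"
      by (auto simp: eventually_sequentially)
    have "1 / K = (real (2 ^ k) / K) * (1 / 2) ^ k"
      by (simp add: power_divide)
    also have "\<dots> \<le> (len 1 + real k * S + C) * (1 / 2) ^ k"
      using lower[of "2 ^ k"] up[of k] by (intro mult_right_mono) auto
    also have "\<dots> < 1 / K" using k by (simp add: algebra_simps)
    finally show False by simp
  qed
  then show thesis using that by blast
qed

text \<open>A power of a loxodromic element satisfies the gap condition of \<open>hyperbolic_axis\<close> by the previous lemma.\<close>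

lemma signed_cocycle_if_amenable_loxodromic:
  assumes G: "group G" and amenable: "amenable_group G"
    and hyp: "hyperbolic_space M d" and act: "isometric_action G M d \<phi>"
    and g: "g \<in> carrier G" and lox: "loxodromic G M d \<phi> g"
  obtains \<epsilon> and c :: "'a \<Rightarrow> real" and b
    where "signed_cocycle G \<epsilon> c" "b \<in> carrier G" "\<epsilon> b = 1" "c b \<noteq> 0"
proof -
  interpret group G by fact
  interpret Metric_space M d using hyp by (simp add: hyperbolic_space_def)
  interpret group_action G M \<phi> using act by (simp add: isometric_action_def)
  obtain \<mu> where \<mu>: "left_invariant_mean G \<mu>" using amenable by (auto simp: amenable_group_def)
  obtain \<delta> where \<delta>: "\<delta> \<ge> 0" and four: "\<And>w x y z. \<lbrakk>w \<in> M; x \<in> M; y \<in> M; z \<in> M\<rbrakk> \<Longrightarrow>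
      d x z + d y w \<le> max (d x y + d z w) (d x w + d y z) + 2 * \<delta>"
    using gromov_hyperbolic_four_point[of M d] hyp unfolding hyperbolic_space_def by metis
  obtain x K C where x: "x \<in> M" and K: "K \<ge> 1"
    and qi: "\<And>m n::int. \<bar>real_of_int m - real_of_int n\<bar> / K - C
        \<le> d (\<phi> (g [^]\<^bsub>G\<^esub> m) x) (\<phi> (g [^]\<^bsub>G\<^esub> n) x)"
    using lox unfolding loxodromic_def quasi_isometric_embedding_def by blast
  define len where "len n = d x (\<phi> (g [^]\<^bsub>G\<^esub> int n) x)" for n
  have one: "\<phi> \<one>\<^bsub>G\<^esub> x = x" using id_eq_one x by (metis restrict_apply)
  have "real n / K - C \<le> len n" for n
    using qi[of 0 "int n"] one by (simp add: len_def)
  then obtain N where N: "len N + (4 * \<delta> + 1) \<le> len (2 * N)"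
    using exists_scale_gap[of K C len "4 * \<delta> + 1"] K by auto
  define a where "a = g [^]\<^bsub>G\<^esub> int N"
  have a: "a \<in> carrier G" by (simp add: a_def g)
  define p where "p i = \<phi> (a [^]\<^bsub>G\<^esub> i) x" for i :: int
  define L where "L n = d x (\<phi> (a [^]\<^bsub>G\<^esub> int n) x)" for n
  have L_len: "L n = len (N * n)" for n
    by (simp add: L_def len_def a_def int_pow_pow g)
  have p_in: "p i \<in> M" for i
    using element_image[OF _ x, of "a [^]\<^bsub>G\<^esub> i"] a by (simp add: p_def)
  have dist_le: "d (p i) (p j) = L (nat (j - i))" if "i \<le> j" for i j
  proof -
    have "p j = \<phi> (a [^]\<^bsub>G\<^esub> i) (\<phi> (a [^]\<^bsub>G\<^esub> (j - i)) x)"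
      unfolding p_def using composition_rule[OF x, of "a [^]\<^bsub>G\<^esub> i" "a [^]\<^bsub>G\<^esub> (j - i)"] a
      by (simp flip: int_pow_mult)
    then have "d (p i) (p j) = d x (\<phi> (a [^]\<^bsub>G\<^esub> (j - i)) x)"
      using act a x element_image[OF _ x, of "a [^]\<^bsub>G\<^esub> (j - i)"]
      unfolding isometric_action_def p_def by simp
    then show ?thesis using that by (simp add: L_def)
  qed
  have dist: "d (p i) (p j) = L (nat \<bar>i - j\<bar>)" for i j
  proof (cases "i \<le> j")
    case False
    then show ?thesis using dist_le[of j i] by (subst commute) simp
  qed (simp add: dist_le)
  have gap: "L 1 + 4 * \<delta> + 1 \<le> L 2"
    using N by (simp add: L_len mult.commute)
  interpret amenable_axis G \<mu> M d \<delta> p L \<phi> x a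
    by unfold_locales (use \<mu> \<delta> four p_in dist gap act x a in \<open>auto simp: p_def\<close>)
  show thesis using exists_signed_cocycle that by blast
qed

section \<open>Actions of amenable groups on hyperbolic spaces\<close>

theorem corollary1p5:
  fixes G :: "('a, 'b) monoid_scheme"
  assumes "group G"
    and "finitely_generated_group G"
    and "amenable_group G"
    and "(UNIV :: real set) \<lesssim> (UNIV :: 'x set)"
  shows "property_NL TYPE('x) G \<longleftrightarrow>
    \<not> surjects_onto G integer_group \<and> \<not> surjects_onto G infinite_dihedral_group"
proof -
  interpret group G by fact
  have "\<not> property_NL TYPE('x) G" if "surjects_onto G integer_group"
    using signed_cocycle_if_surjects_onto_integers[OF that]
      not_property_NL_if_signed_cocycle[OF _ _ _ _ assms(4)] by metis
  moreover have "\<not> property_NL TYPE('x) G" if "surjects_onto G infinite_dihedral_group"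
    using signed_cocycle_if_surjects_onto_dihedral[OF that]
      not_property_NL_if_signed_cocycle[OF _ _ _ _ assms(4)] by metis
  moreover have "surjects_onto G integer_group \<or> surjects_onto G infinite_dihedral_group"
    if nl: "\<not> property_NL TYPE('x) G"
  proof -
    obtain M :: "'x set" and d \<phi> g where "hyperbolic_space M d" "isometric_action G M d \<phi>"
        "g \<in> carrier G" "loxodromic G M d \<phi> g"
      using nl unfolding property_NL_def by blast
    then obtain \<epsilon> and c :: "'a \<Rightarrow> real" and b
      where c: "signed_cocycle G \<epsilon> c" and b: "b \<in> carrier G" "\<epsilon> b = 1" "c b \<noteq> 0"
      by (rule signed_cocycle_if_amenable_loxodromic[OF assms(1,3)])
    obtain c' :: "'a \<Rightarrow> int" where "signed_cocycle G \<epsilon> c'" "c' b \<noteq> 0"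
      by (rule signed_cocycle_real_imp_int[OF assms(2) c b(1,3)])
    with b(1,2) show ?thesis by (intro signed_cocycle_int_imp_surjects)
  qed
  ultimately show ?thesis by blast
qed

end
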